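(* Let $H\in(0,1)$ and let $(L_t)_{t\in\mathbb R}$ be a two-sided Lévy process without Gaussian component with $\mathbb E L_1=0$, $\mathbb E L_1^2<\infty$. For $s>0$ and $t\ge -s$ set $$Z^s_t=\int_{-s}^{t} z_H(t+s,v+s)\,dL_v-\int_{-s}^{0} z_H(s,v+s)\,dL_v$$ (i.e. $Z^s_t=Y^s_{t+s}-Y^s_s$ with $Y^s_r=\int_0^r z_H(r,u)\,dL_{u-s}$), and for $t\in\mathbb R$ set $$Z^\infty_t=c_H\int_{\mathbb R}\big((t-v)_+^{H-1/2}-(-v)_+^{H-1/2}\big)\,dL_v.$$ Then for every $t\in\mathbb R$ there exist constants $S,C>0$ such that $\mathbb E(Z^s_t-Z^\infty_t)^2\le C s^{2H-2}$ for all $s>S$.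
   Context: A two-sided Lévy process is $L_t=L^{(1)}_t$ for $t\ge0$ and $L_t=-L^{(2)}_{-(t-)}$ for $t<0$, with $L^{(1)},L^{(2)}$ i.i.d. Lévy processes. Molchan–Golosov kernel: $z_H(t,s)=c_H(t-s)^{H-1/2}F\big(\tfrac12-H,H-\tfrac12,H+\tfrac12,\tfrac{s-t}{s}\big)$ for $0<s<t$, $z_H(t,s)=0$ otherwise, where $F(a,b,c,x)=\sum_{j\ge0}\frac{(a)_j(b)_j}{(c)_j}\frac{x^j}{j!}$ ($(a)_0=1$, $(a)_k=a(a+1)\cdots(a+k-1)$) and $c_H=\frac{1}{\Gamma(H+1/2)}\big(\frac{2H\Gamma(H+1/2)\Gamma(3/2-H)}{\Gamma(2-2H)}\big)^{1/2}$. All integrals are $L^2(\mathbb P)$-limits of integrals of step functions.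
   Formalization: The series defining F diverges at (s−t)/s < −1 (that is, s < t/2), so the kernel z_H is undefined there as written; F is taken there as the analytic continuation of the series, given by Pfaff's transformation. *)

theory Defs
  imports "HOL-Probability.Probability"
begin

definition levy_process :: "'a measure \<Rightarrow> (real \<Rightarrow> 'a \<Rightarrow> real) \<Rightarrow> bool" where
  "levy_process M X \<longleftrightarrow>
     prob_space M \<and>
     (\<forall>t\<ge>0. X t \<in> borel_measurable M) \<and>
     (AE \<omega> in M. X 0 \<omega> = 0) \<and>
     (\<forall>(n::nat) (t::nat \<Rightarrow> real). (\<forall>i<n. 0 \<le> t i \<and> t i \<le> t (Suc i)) \<longrightarrow>
        prob_space.indep_vars M (\<lambda>_. borel) (\<lambda>i \<omega>. X (t (Suc i)) \<omega> - X (t i) \<omega>) {..<n}) \<and>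
     (\<forall>s t. 0 \<le> s \<longrightarrow> s \<le> t \<longrightarrow>
        distr M borel (\<lambda>\<omega>. X t \<omega> - X s \<omega>) = distr M borel (X (t - s))) \<and>
     (\<forall>t\<ge>0. \<forall>e>0.
        ((\<lambda>h. measure M {\<omega>\<in>space M. \<bar>X h \<omega> - X t \<omega>\<bar> > e}) \<longlongrightarrow> 0) (at t within {0..})) \<and>
     (AE \<omega> in M. \<forall>t\<ge>0. continuous (at_right t) (\<lambda>u. X u \<omega>) \<and>
        (t > 0 \<longrightarrow> (\<exists>l. ((\<lambda>u. X u \<omega>) \<longlongrightarrow> l) (at_left t))))"

text \<open>No Gaussian component: the Levy-Khintchine triplet of L_1 has zero Gaussian part.\<close>
definition no_gaussian_part :: "'a measure \<Rightarrow> (real \<Rightarrow> 'a \<Rightarrow> real) \<Rightarrow> bool" where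
  "no_gaussian_part M X \<longleftrightarrow>
     (\<exists>(\<gamma>::real) (\<nu>::real measure).
        sets \<nu> = sets borel \<and> emeasure \<nu> {0} = 0 \<and>
        (\<integral>\<^sup>+ x. ennreal (min 1 (x\<^sup>2)) \<partial>\<nu>) < \<infinity> \<and>
        (\<forall>u. char (distr M borel (X 1)) u =
           exp (\<i> * complex_of_real (\<gamma> * u) +
             (CLINT x|\<nu>. iexp (u * x) - 1 - \<i> * complex_of_real (u * x * indicator {-1..1} x)))))"

definition two_sided :: "(real \<Rightarrow> 'a \<Rightarrow> real) \<Rightarrow> (real \<Rightarrow> 'a \<Rightarrow> real) \<Rightarrow> real \<Rightarrow> 'a \<Rightarrow> real" where
  "two_sided L1 L2 t \<omega> =
     (if t \<ge> 0 then L1 t \<omega> else - Lim (at_left (-t)) (\<lambda>u. L2 u \<omega>))"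

definition step_fun :: "(real \<times> real \<times> real) list \<Rightarrow> real \<Rightarrow> real" where
  "step_fun ps v = (\<Sum>(c, a, b)\<leftarrow>ps. c * indicator {a<..b} v)"

definition step_int :: "(real \<Rightarrow> 'a \<Rightarrow> real) \<Rightarrow> (real \<times> real \<times> real) list \<Rightarrow> 'a \<Rightarrow> real" where
  "step_int L ps \<omega> = (\<Sum>(c, a, b)\<leftarrow>ps. c * (L b \<omega> - L a \<omega>))"

definition valid_steps :: "(real \<times> real \<times> real) list \<Rightarrow> bool" where
  "valid_steps ps \<longleftrightarrow> list_all (\<lambda>(c, a, b). a \<le> b) ps"

definition is_L_integral :: "'a measure \<Rightarrow> (real \<Rightarrow> 'a \<Rightarrow> real) \<Rightarrow> (real \<Rightarrow> real) \<Rightarrow> ('a \<Rightarrow> real) \<Rightarrow> bool" where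
  "is_L_integral M L f X \<longleftrightarrow>
     X \<in> borel_measurable M \<and>
     (\<exists>ps :: nat \<Rightarrow> (real \<times> real \<times> real) list.
        (\<forall>n. valid_steps (ps n)) \<and>
        ((\<lambda>n. \<integral>\<^sup>+ v. ennreal ((f v - step_fun (ps n) v)\<^sup>2) \<partial>lborel) \<longlonglongrightarrow> 0) \<and>
        ((\<lambda>n. \<integral>\<^sup>+ \<omega>. ennreal ((X \<omega> - step_int L (ps n) \<omega>)\<^sup>2) \<partial>M) \<longlonglongrightarrow> 0))"

definition hyp_series :: "real \<Rightarrow> real \<Rightarrow> real \<Rightarrow> real \<Rightarrow> real" where
  "hyp_series a b c x = (\<Sum>j. pochhammer a j * pochhammer b j / pochhammer c j * x ^ j / fact j)"

text \<open>Gauss hypergeometric function F(a,b,c,x): the series for |x| < 1; for x \<le> -1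
  its analytic continuation, given by Pfaff's transformation
  F(a,b,c,x) = (1-x)^(-a) F(a,c-b,c,x/(x-1)).\<close>
definition hyp2F1 :: "real \<Rightarrow> real \<Rightarrow> real \<Rightarrow> real \<Rightarrow> real" where
  "hyp2F1 a b c x =
     (if \<bar>x\<bar> < 1 then hyp_series a b c x
      else (1 - x) powr (-a) * hyp_series a (c - b) c (x / (x - 1)))"

definition c_H :: "real \<Rightarrow> real" where
  "c_H H = 1 / Gamma (H + 1/2) *
     sqrt (2 * H * Gamma (H + 1/2) * Gamma (3/2 - H) / Gamma (2 - 2 * H))"

definition z_H :: "real \<Rightarrow> real \<Rightarrow> real \<Rightarrow> real" where
  "z_H H t s =
     (if 0 < s \<and> s < t
      then c_H H * (t - s) powr (H - 1/2) * hyp2F1 (1/2 - H) (H - 1/2) (H + 1/2) ((s - t) / s)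
      else 0)"

definition pos_pow :: "real \<Rightarrow> real \<Rightarrow> real" where
  "pos_pow x a = (if x > 0 then x powr a else 0)"

end

theory Submission
  imports Defs
begin

text \<open>
  Write \<open>b = H - 1/2\<close>. By the Ito-type isometry for square integrable centred Levy processes it
  suffices to estimate the kernels in \<open>L\<^sup>2\<close>. For fixed \<open>u\<close>, \<open>z_H(r, u) / c_H\<close> and \<open>(r - u)\<^sup>b\<close> have the
  \<open>r\<close>-derivatives \<open>b (r/u)\<^sup>b (r - u)\<^bsup>b-1\<^esup>\<close> and \<open>b (r - u)\<^bsup>b-1\<^esup>\<close>, and their difference vanishes as \<open>r\<close> tends
  to \<open>u\<close>. Hence, after the shift \<open>u = v + s\<close>, the kernel of \<open>Z\<^sup>s\<^sub>t - Z\<^sup>\<infinity>\<^sub>t\<close> is the integral over \<open>r\<close> between \<open>s\<close> and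
  \<open>s + t\<close> of a function whose square has \<open>u\<close>-integral at most a constant times \<open>r\<^bsup>2H-2\<^esup>\<close> (by scaling, a
  Beta integral on \<open>u > 0\<close>). Cauchy--Schwarz and Tonelli give the rate.
\<close>

subsection \<open>The hypergeometric function in the kernel\<close>

text \<open>Passing to derivatives is forced: for u <= 0 the function (r - u)^b is not square
  integrable at u = -infinity, because 2b > -1, whereas its r-derivative is, because 2b - 2 < -1.
  Near u = r the difficulty is the opposite one: b (r - u)^(b-1) alone is not square integrable, and
  only the factor (r/u)^b - 1, which vanishes at r = u, repairs this. Near u = 0 the square grows at
  worst like u^(-2|b|), integrable because |b| < 1/2. The exponent of the rate is homogeneity: the
  squared derivative has degree 2b - 2 in (u, r), and integration over u leaves r^(2b-1) = r^(2H-2).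

  The r-derivative of \<open>z_H\<close> cannot be read off its definition: the argument (u - r)/u
  runs through the whole negative axis, so \<open>hyp2F1\<close> switches formula at r = 2u. Pfaff's
  transformation supplies one formula for all r > u and therefore has to be proved.\<close>

lemma summable_powser_bounded:
  fixes c :: "nat \<Rightarrow> real"
  assumes "\<And>n. \<bar>c n\<bar> \<le> 1" "\<bar>x\<bar> < 1"
  shows "summable (\<lambda>n. c n * x ^ n)"
proof (rule summable_comparison_test)
  show "summable (\<lambda>n. \<bar>x\<bar> ^ n)"
    using assms(2) by (simp add: summable_geometric)
  have "\<bar>c n\<bar> * \<bar>x\<bar> ^ n \<le> \<bar>x\<bar> ^ n" for n
    using assms(1)[of n] by (simp add: mult_left_le_one_le)
  then show "\<exists>N. \<forall>n\<ge>N. norm (c n * x ^ n) \<le> \<bar>x\<bar> ^ n"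
    by (auto simp: abs_mult power_abs)
qed

text \<open>The parameters 1/2 - H, H - 1/2, H + 1/2 in \<open>z_H\<close> are -b, b, b + 1.\<close>

definition kernel_coeff :: "real \<Rightarrow> nat \<Rightarrow> real" where
  "kernel_coeff b j = pochhammer (-b) j * pochhammer b j / pochhammer (b + 1) j / fact j"

text \<open>Pfaff's transformation turns the parameters (-b, b, b + 1) into (-b, 1, b + 1). The
  parameter 1 contributes j!, which cancels the factorial of the series.\<close>

definition pfaff_coeff :: "real \<Rightarrow> nat \<Rightarrow> real" where
  "pfaff_coeff b j = pochhammer (-b) j / pochhammer (b + 1) j"

lemma hyp_series_kernel:
  "hyp_series (-b) b (b + 1) x = (\<Sum>j. kernel_coeff b j * x ^ j)"
  by (simp add: hyp_series_def kernel_coeff_def)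

lemma hyp_series_pfaff:
  "hyp_series (-b) 1 (b + 1) x = (\<Sum>j. pfaff_coeff b j * x ^ j)"
  by (simp add: hyp_series_def pfaff_coeff_def pochhammer_fact[symmetric])

text \<open>The ratio of consecutive coefficients is (j - b)/(j + 1 + b), of absolute value at most
  1 because b > -1/2.\<close>

lemma abs_pfaff_coeff_le:
  assumes "\<bar>b\<bar> < 1/2"
  shows "\<bar>pfaff_coeff b j\<bar> \<le> 1"
proof (induction j)
  case (Suc j)
  have "pfaff_coeff b (Suc j) = pfaff_coeff b j * ((real j - b) / (b + 1 + real j))"
    by (simp add: pfaff_coeff_def pochhammer_Suc algebra_simps)
  moreover have "\<bar>(real j - b) / (b + 1 + real j)\<bar> \<le> 1"
    using assms by (simp add: abs_divide field_simps)
  ultimately show ?case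
    using Suc by (simp only: abs_mult mult_le_one abs_ge_zero)
qed (simp add: pfaff_coeff_def)

lemma abs_kernel_coeff_le:
  assumes "\<bar>b\<bar> < 1/2"
  shows "\<bar>kernel_coeff b j\<bar> \<le> 1"
proof -
  have "\<bar>pochhammer b j / fact j\<bar> \<le> 1"
  proof (induction j)
    case (Suc j)
    have "pochhammer b (Suc j) / fact (Suc j) = pochhammer b j / fact j * ((b + real j) / (1 + real j))"
      by (simp add: pochhammer_Suc)
    moreover have "\<bar>(b + real j) / (1 + real j)\<bar> \<le> 1"
      using assms by (simp add: abs_divide field_simps)
    ultimately show ?case
      using Suc by (simp only: abs_mult mult_le_one abs_ge_zero)
  qed simp
  moreover have "kernel_coeff b j = pfaff_coeff b j * (pochhammer b j / fact j)"
    by (simp add: kernel_coeff_def pfaff_coeff_def)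
  ultimately show ?thesis
    using abs_pfaff_coeff_le[OF assms, of j] by (simp only: abs_mult mult_le_one abs_ge_zero)
qed

text \<open>Telescoping gives (b)_j / (b + 1)_j = b/(b + j). Hence the factor b + j, which appears
  when y^(b+j) is differentiated, turns the hypergeometric series into a binomial one.\<close>

lemma kernel_coeff_gbinomial:
  assumes "\<bar>b\<bar> < 1/2"
  shows "(b + real j) * kernel_coeff b j * (-1) ^ j = b * (b gchoose j)"
proof -
  have "pochhammer b j * (b + real j) = b * pochhammer (b + 1) j"
    by (metis pochhammer_Suc pochhammer_rec)
  moreover have "0 < pochhammer (b + 1) j"
    using assms by (intro pochhammer_pos) linarith
  ultimately have "(b + real j) * (pochhammer b j / pochhammer (b + 1) j) = b"
    by (simp add: field_simps)
  moreover have "(b + real j) * kernel_coeff b j * (-1) ^ j =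
    (b + real j) * (pochhammer b j / pochhammer (b + 1) j) * (b gchoose j)"
    by (simp add: gbinomial_pochhammer kernel_coeff_def)
  ultimately show ?thesis by simp
qed

lemma pfaff_coeff_Suc:
  assumes "\<bar>b\<bar> < 1/2"
  shows "pfaff_coeff b (Suc j) * (b + 1 + real j) = pfaff_coeff b j * (real j - b)"
proof -
  have "0 < b + 1" using assms by linarith
  then have "pochhammer (b + 1) j \<noteq> 0" "b + 1 + real j \<noteq> 0"
    using pochhammer_pos[of "b + 1" j] by linarith+
  then show ?thesis
    by (simp add: pfaff_coeff_def pochhammer_Suc)
qed

text \<open>Termwise, y^b times the sum of c_j y^j has derivative y^(b-1) times the sum of (b + j)
  c_j y^j, and by \<open>kernel_coeff_gbinomial\<close> the latter is the binomial series of b (1 +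
  y)^b.\<close>

lemma hyp_series_kernel_deriv:
  assumes b: "\<bar>b\<bar> < 1/2" and y: "0 < y" "y < 1"
  shows "((\<lambda>y. y powr b * hyp_series (-b) b (b + 1) (-y)) has_real_derivative
           b * y powr (b - 1) * (1 + y) powr b) (at y)"
proof -
  define c where "c j = kernel_coeff b j * (-1) ^ j" for j
  have c1: "\<bar>c n\<bar> \<le> 1" for n
    using abs_kernel_coeff_le[OF b, of n] by (simp add: c_def abs_mult)
  have F: "hyp_series (-b) b (b + 1) (-z) = (\<Sum>j. c j * z ^ j)" for z
    unfolding hyp_series_kernel c_def by (intro suminf_cong) (simp add: power_minus[of z])
  have sm: "summable (\<lambda>n. c n * z ^ n)" if "norm z < 1" for z
    using summable_powser_bounded[of c z] c1 that by simp
  have D: "((\<lambda>z. \<Sum>n. c n * z ^ n) has_real_derivative (\<Sum>n. diffs c n * y ^ n)) (at y)"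
    using y by (intro termdiffs_strong'[OF sm]) auto
  have sm': "summable (\<lambda>n. diffs c n * y ^ n)"
    using y by (intro termdiff_converges[of y 1] sm) auto
  have "(\<lambda>n. real n * c n * y ^ (n - Suc 0)) sums (\<Sum>n. diffs c n * y ^ n)"
    using diffs_equiv[OF sm'] .
  then have "(\<lambda>n. y * (real n * c n * y ^ (n - Suc 0))) sums (y * (\<Sum>n. diffs c n * y ^ n))"
    by (rule sums_mult)
  also have "(\<lambda>n. y * (real n * c n * y ^ (n - Suc 0))) = (\<lambda>n. real n * c n * y ^ n)"
  proof
    fix n show "y * (real n * c n * y ^ (n - Suc 0)) = real n * c n * y ^ n"
      by (cases n) auto
  qed
  finally have s1: "(\<lambda>n. real n * c n * y ^ n) sums (y * (\<Sum>n. diffs c n * y ^ n))" .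
  have "(\<lambda>n. b * (c n * y ^ n)) sums (b * (\<Sum>n. c n * y ^ n))"
    using y by (intro sums_mult summable_sums sm) auto
  from sums_add[OF this s1]
  have "(\<lambda>n. b * (b gchoose n) * y ^ n) sums (b * (\<Sum>n. c n * y ^ n) + y * (\<Sum>n. diffs c n * y ^ n))"
    by (simp add: kernel_coeff_gbinomial[OF b, symmetric] c_def algebra_simps)
  moreover have "(\<lambda>n. b * (b gchoose n) * y ^ n) sums (b * (1 + y) powr b)"
    using sums_mult[OF gen_binomial_real[of y b], of b] y by (simp add: mult.assoc)
  ultimately have key: "b * (\<Sum>n. c n * y ^ n) + y * (\<Sum>n. diffs c n * y ^ n) = b * (1 + y) powr b"
    by (rule sums_unique2)
  have yb: "y powr b = y powr (b - 1) * y"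
    using y by (simp add: powr_diff)
  have "((\<lambda>y. y powr b * (\<Sum>n. c n * y ^ n)) has_real_derivative
      (b * y powr (b - 1) * (\<Sum>n. c n * y ^ n) + (\<Sum>n. diffs c n * y ^ n) * y powr b)) (at y)"
    using y by (intro DERIV_mult has_real_derivative_powr D) auto
  also have "b * y powr (b - 1) * (\<Sum>n. c n * y ^ n) + (\<Sum>n. diffs c n * y ^ n) * y powr b
     = y powr (b - 1) * (b * (\<Sum>n. c n * y ^ n) + y * (\<Sum>n. diffs c n * y ^ n))"
    by (simp add: yb algebra_simps)
  finally show ?thesis
    unfolding F key by (simp add: ac_simps)
qed

text \<open>The two-term recurrence \<open>pfaff_coeff_Suc\<close> becomes a first order linear
  differential equation for the sum. This equation takes over the role that the binomial series has
  for the untransformed series.\<close>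

lemma hyp_series_pfaff_deriv:
  assumes b: "\<bar>b\<bar> < 1/2" and q: "\<bar>q\<bar> < 1"
  obtains P' where "((\<lambda>q. hyp_series (-b) 1 (b + 1) q) has_real_derivative P') (at q)"
    "q * (1 - q) * P' + b * (1 + q) * hyp_series (-b) 1 (b + 1) q = b"
proof
  define c where "c = pfaff_coeff b"
  define P where "P z = (\<Sum>j. c j * z ^ j)" for z
  have c1: "\<bar>c n\<bar> \<le> 1" for n
    using abs_pfaff_coeff_le[OF b, of n] by (simp add: c_def)
  have sm: "summable (\<lambda>n. c n * z ^ n)" if "norm z < 1" for z
    using summable_powser_bounded[of c z] c1 that by simp
  show "((\<lambda>q. hyp_series (-b) 1 (b + 1) q) has_real_derivative (\<Sum>n. diffs c n * q ^ n)) (at q)"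
    unfolding hyp_series_pfaff c_def[symmetric] using q by (intro termdiffs_strong'[OF sm]) auto
  have sm': "summable (\<lambda>n. diffs c n * q ^ n)"
    using q by (intro termdiff_converges[of q 1] sm) auto
  define P' where "P' = (\<Sum>n. diffs c n * q ^ n)"
  have s0: "(\<lambda>n. c n * q ^ n) sums P q"
    unfolding P_def using q by (intro summable_sums sm) auto
  have s1: "(\<lambda>n. diffs c n * q ^ n) sums P'"
    unfolding P'_def using sm' by (rule summable_sums)
  have s2: "(\<lambda>n. real n * c n * q ^ n) sums (q * P')"
  proof -
    have "(\<lambda>n. q * (real n * c n * q ^ (n - Suc 0))) sums (q * P')"
      unfolding P'_def by (intro sums_mult diffs_equiv[OF sm'])
    also have "(\<lambda>n. q * (real n * c n * q ^ (n - Suc 0))) = (\<lambda>n. real n * c n * q ^ n)"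
    proof
      fix n show "q * (real n * c n * q ^ (n - Suc 0)) = real n * c n * q ^ n"
        by (cases n) auto
    qed
    finally show ?thesis .
  qed
  have "(\<lambda>n. c (Suc n) * q ^ Suc n) sums (P q - 1)"
    using s0 by (subst sums_Suc_iff) (simp add: c_def pfaff_coeff_def)
  \<comment> \<open>The series of c_(n+1) (b + 1 + n) q^(n+1) is summed twice: split as (n + 1) + b
    it gives q P' + b (P - 1), where 1 is the missing term c_0; rewritten by the recurrence as (n -
    b) c_n it gives q (q P' - b P).\<close>
  from sums_add[OF sums_mult[OF s1, of q] sums_mult[OF this, of b]]
  have "(\<lambda>n. q * (c (Suc n) * (b + 1 + real n) * q ^ n)) sums (q * P' + b * (P q - 1))"
    by (simp add: diffs_def algebra_simps)
  moreover have "(\<lambda>n. q * (c (Suc n) * (b + 1 + real n) * q ^ n)) sums (q * (q * P' - b * P q))"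
    using sums_mult[OF sums_diff[OF s2 sums_mult[OF s0, of b]], of q]
    unfolding c_def pfaff_coeff_Suc[OF b] by (simp add: algebra_simps)
  ultimately have "q * P' + b * (P q - 1) = q * (q * P' - b * P q)"
    by (rule sums_unique2)
  then show "q * (1 - q) * (\<Sum>n. diffs c n * q ^ n) + b * (1 + q) * hyp_series (-b) 1 (b + 1) q = b"
    unfolding hyp_series_pfaff c_def[symmetric] P_def[symmetric] P'_def[symmetric]
    by (simp add: algebra_simps)
qed

text \<open>The factor y^b may blow up, but f(y) - 1 is of order y, so the product is of order
  y^(b+1).\<close>

lemma tendsto_powr_mult_diff_one:
  fixes f :: "real \<Rightarrow> real"
  assumes "b > -1" "(f has_real_derivative D) (at 0)" "f 0 = 1"
  shows "((\<lambda>y. y powr b * (f y - 1)) \<longlongrightarrow> 0) (at_right 0)"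
proof -
  have "((\<lambda>y. (f y - 1) / y) \<longlongrightarrow> D) (at_right 0)"
    by (rule tendsto_mono[OF at_le[OF subset_UNIV]])
      (use assms(2,3) in \<open>simp add: has_field_derivative_iff\<close>)
  moreover have "((\<lambda>y. y powr (b + 1)) \<longlongrightarrow> 0) (at_right 0)"
    using assms(1) by (intro tendsto_eq_intros) (auto simp: eventually_at_filter)
  ultimately have "((\<lambda>y. y powr (b + 1) * ((f y - 1) / y)) \<longlongrightarrow> 0 * D) (at_right 0)"
    by (intro tendsto_mult)
  moreover have "eventually (\<lambda>y. y powr (b + 1) * ((f y - 1) / y) = y powr b * (f y - 1)) (at_right 0)"
    using eventually_at_right_less[of 0] by eventually_elim (simp add: powr_add)
  ultimately have "((\<lambda>y. y powr b * (f y - 1)) \<longlongrightarrow> 0 * D) (at_right 0)"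
    by (rule Lim_transform_eventually)
  then show ?thesis by simp
qed

text \<open>The value F(-b, b, b + 1, -y) in Pfaff's form. The new argument y/(1 + y) stays in [0,
  1) for every y >= 0, so the series converges throughout.\<close>

definition pfaff_form :: "real \<Rightarrow> real \<Rightarrow> real" where
  "pfaff_form b y = (1 + y) powr b * hyp_series (-b) 1 (b + 1) (y / (1 + y))"

text \<open>With q = y/(1 + y) the product rule yields y^(b-1) (1 + y)^b times b (1 + q) P + q (1 -
  q) P', and the differential equation of \<open>hyp_series_pfaff_deriv\<close> says that this last
  expression is b.\<close>

lemma pfaff_form_deriv:
  assumes b: "\<bar>b\<bar> < 1/2" and y: "0 < y"
  shows "((\<lambda>y. y powr b * pfaff_form b y) has_real_derivative
           b * y powr (b - 1) * (1 + y) powr b) (at y)"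
proof -
  define q where "q = y / (1 + y)"
  define P where "P = hyp_series (-b) 1 (b + 1)"
  have q: "\<bar>q\<bar> < 1" "1 - q = 1 / (1 + y)" "y = q * (1 + y)"
    using y by (auto simp: q_def field_simps)
  obtain P' where P': "(P has_real_derivative P') (at q)"
      "q * (1 - q) * P' + b * (1 + q) * P q = b"
    unfolding P_def using hyp_series_pfaff_deriv[OF b q(1)] by blast
  have dq: "((\<lambda>y. y / (1 + y)) has_real_derivative 1 / (1 + y)\<^sup>2) (at y)"
    using y by (auto intro!: derivative_eq_intros simp: power2_eq_square)
  have dP: "((\<lambda>y. P (y / (1 + y))) has_real_derivative P' * (1 / (1 + y)\<^sup>2)) (at y)"
    using P'(1) by (intro DERIV_chain2[OF _ dq]) (simp add: q_def)
  have "((\<lambda>y. y powr b * ((1 + y) powr b * P (y / (1 + y)))) has_real_derivative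
     (b * y powr (b - 1) * ((1 + y) powr b * P q) +
      (b * (1 + y) powr (b - 1) * 1 * P q + P' * (1 / (1 + y)\<^sup>2) * (1 + y) powr b) * y powr b)) (at y)"
    unfolding q_def using y
    by (intro DERIV_mult dP has_real_derivative_powr DERIV_chain2[OF has_real_derivative_powr])
      (auto intro!: derivative_eq_intros)
  also have "b * y powr (b - 1) * ((1 + y) powr b * P q) +
      (b * (1 + y) powr (b - 1) * 1 * P q + P' * (1 / (1 + y)\<^sup>2) * (1 + y) powr b) * y powr b
    = y powr (b - 1) * (1 + y) powr b * (b * P q + b * (y / (1 + y)) * P q + (y / (1 + y)) * (1 / (1 + y)) * P')"
    using y by (simp add: powr_diff field_simps power2_eq_square)
  also have "b * P q + b * (y / (1 + y)) * P q + (y / (1 + y)) * (1 / (1 + y)) * P' = b"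
    using P'(2) unfolding q(2)[symmetric] q_def[symmetric] by (simp add: algebra_simps)
  finally show ?thesis
    by (simp add: pfaff_form_def P_def ac_simps)
qed

lemma pfaff_form_zero: "pfaff_form b 0 = 1"
proof -
  have "(\<lambda>j. pfaff_coeff b j * 0 ^ j) sums pfaff_coeff b 0"
    using powser_sums_zero by blast
  then show ?thesis
    unfolding pfaff_form_def hyp_series_pfaff by (simp add: sums_iff pfaff_coeff_def)
qed

text \<open>Needed at two places: it fixes the constant of integration in Pfaff's transformation,
  and it makes \<open>kernel_defect\<close> continuous at r = u.\<close>

lemma pfaff_form_tendsto:
  assumes b: "\<bar>b\<bar> < 1/2"
  shows "((\<lambda>y. y powr b * (pfaff_form b y - 1)) \<longlongrightarrow> 0) (at_right 0)"
proof -
  define P where "P = hyp_series (-b) 1 (b + 1)"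
  obtain P' where P': "(P has_real_derivative P') (at 0)"
    unfolding P_def using hyp_series_pfaff_deriv[OF b, of 0] by auto
  have dq: "((\<lambda>y. y / (1 + y)) has_real_derivative 1) (at (0::real))"
    by (auto intro!: derivative_eq_intros simp: power2_eq_square)
  have "((\<lambda>y. P (y / (1 + y))) has_real_derivative P' * 1) (at 0)"
    using P' by (intro DERIV_chain2[OF _ dq]) simp
  then have "((\<lambda>y. (1 + y) powr b * P (y / (1 + y))) has_real_derivative
     b * P 0 + P' * 1) (at 0)"
    by (auto intro!: derivative_eq_intros)
  from tendsto_powr_mult_diff_one[of b "pfaff_form b", OF _ this[folded pfaff_form_def[of b, folded P_def]] pfaff_form_zero] b
  show ?thesis by linarith
qed

lemma kernel_series_tendsto:
  assumes b: "\<bar>b\<bar> < 1/2"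
  shows "((\<lambda>y. y powr b * (hyp_series (-b) b (b + 1) (-y) - 1)) \<longlongrightarrow> 0) (at_right 0)"
proof -
  have sm: "summable (\<lambda>n. kernel_coeff b n * z ^ n)" if "norm z < 1" for z
    using summable_powser_bounded abs_kernel_coeff_le[OF b] that by simp
  have d: "((\<lambda>z. \<Sum>n. kernel_coeff b n * z ^ n) has_real_derivative
      (\<Sum>n. diffs (kernel_coeff b) n * 0 ^ n)) (at (- 0))"
    using termdiffs_strong'[OF sm, where z = 0 and K = 1] by simp
  have "((\<lambda>y. - y) has_real_derivative -1) (at (0::real))"
    by (auto intro!: derivative_eq_intros)
  from DERIV_chain2[where x = 0 and s = UNIV and g = "\<lambda>y. - y" and Db = "-1", OF d this]
  have "((\<lambda>y. hyp_series (-b) b (b + 1) (-y)) has_real_derivative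
      (\<Sum>n. diffs (kernel_coeff b) n * 0 ^ n) * (-1)) (at 0)"
    by (simp add: hyp_series_kernel)
  moreover have "hyp_series (-b) b (b + 1) (-0) = 1"
    using powser_sums_zero[of "kernel_coeff b"]
    by (simp add: hyp_series_kernel sums_iff) (simp add: kernel_coeff_def)
  ultimately show ?thesis
    using b by (intro tendsto_powr_mult_diff_one) auto
qed

text \<open>Pfaff's transformation: both sides times \<open>y\<^sup>b\<close> have the same derivative, and the
  difference of these products tends to 0 at 0.\<close>

lemma hyp_series_kernel_eq_pfaff_form:
  assumes b: "\<bar>b\<bar> < 1/2" and y: "0 < y" "y < 1"
  shows "hyp_series (-b) b (b + 1) (-y) = pfaff_form b y"
proof -
  define D where "D z = z powr b * hyp_series (-b) b (b + 1) (-z) - z powr b * pfaff_form b z" for z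
  have "(D has_real_derivative 0) (at z)" if "0 < z" "z < 1" for z
    using DERIV_diff[OF hyp_series_kernel_deriv[OF b that] pfaff_form_deriv[OF b that(1)]]
    by (simp add: D_def[abs_def])
  then have "\<exists>c. \<forall>z\<in>{0<..<1}. D z = c"
    by (intro has_field_derivative_zero_constant) (auto intro: has_field_derivative_at_within)
  then obtain c where c: "\<And>z. 0 < z \<Longrightarrow> z < 1 \<Longrightarrow> D z = c"
    by auto
  have "(D \<longlongrightarrow> 0) (at_right 0)"
    using tendsto_diff[OF kernel_series_tendsto[OF b] pfaff_form_tendsto[OF b]]
    unfolding D_def[abs_def] right_diff_distrib by simp
  moreover have "(D \<longlongrightarrow> c) (at_right 0)"
    by (rule tendsto_eventually) (auto simp: eventually_at_right[of 0 "1::real"] intro!: exI[of _ 1] c)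
  ultimately have "c = 0"
    by (intro tendsto_unique[OF trivial_limit_at_right_real])
  then show ?thesis
    using c[OF y] y by (simp add: D_def)
qed

text \<open>For y < 1 this is the identity just proved, for y >= 1 it is the second branch of the
  definition. The merged formula can be differentiated across y = 1.\<close>

lemma hyp2F1_eq_pfaff_form:
  assumes "\<bar>b\<bar> < 1/2" "0 < y"
  shows "hyp2F1 (-b) b (b + 1) (-y) = pfaff_form b y"
proof (cases "y < 1")
  case True
  then show ?thesis
    using hyp_series_kernel_eq_pfaff_form[OF assms] assms(2) by (simp add: hyp2F1_def)
next
  case False
  have "- y / (- y - 1) = y / (1 + y)"
    using assms(2) by (simp add: field_simps)
  then show ?thesis
    using False by (simp add: hyp2F1_def pfaff_form_def)
qed

subsection \<open>The kernel difference in mean square\<close>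

text \<open>For \<open>u > 0\<close> this is \<open>(z_H(r, u) - c_H (r - u)\<^sub>+\<^sup>b) / c_H\<close>; for \<open>u \<le> 0\<close>, where
  \<open>z_H\<close> vanishes, only the second summand remains.\<close>

definition kernel_defect :: "real \<Rightarrow> real \<Rightarrow> real \<Rightarrow> real" where
  "kernel_defect b u r =
     (if u \<le> 0 then - ((r - u) powr b)
      else if u < r then (r - u) powr b * (pfaff_form b ((r - u) / u) - 1)
      else 0)"

definition kernel_defect' :: "real \<Rightarrow> real \<Rightarrow> real \<Rightarrow> real" where
  "kernel_defect' b u r =
     (if u \<le> 0 then - (b * (r - u) powr (b - 1))
      else if u < r then b * (r - u) powr (b - 1) * ((r / u) powr b - 1)
      else 0)"

lemma z_H_eq_kernel_defect:
  assumes "0 < H" "H < 1" "0 < r"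
  shows "z_H H r u - c_H H * pos_pow (r - u) (H - 1/2) = c_H H * kernel_defect (H - 1/2) u r"
proof (cases "0 < u \<and> u < r")
  case True
  have "hyp2F1 (- (H - 1/2)) (H - 1/2) (H - 1/2 + 1) (- ((r - u) / u)) = pfaff_form (H - 1/2) ((r - u) / u)"
    using assms True by (intro hyp2F1_eq_pfaff_form abs_leI divide_pos_pos) linarith+
  moreover have "- ((r - u) / u) = (u - r) / u" "H - 1/2 + 1 = H + 1/2"
    by (simp_all add: minus_divide_left)
  ultimately show ?thesis
    using True by (simp add: z_H_def pos_pow_def kernel_defect_def algebra_simps)
next
  case False
  then show ?thesis
    using assms by (auto simp: z_H_def pos_pow_def kernel_defect_def)
qed

text \<open>For 0 < u < r the defect is u^b G(y) with y = (r - u)/u and G(y) = y^b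
  (\<open>pfaff_form b y\<close> - 1), so the chain rule reduces the claim to
  \<open>pfaff_form_deriv\<close>.\<close>

lemma kernel_defect_deriv:
  assumes b: "\<bar>b\<bar> < 1/2" and r: "0 < r" "r \<noteq> u"
  shows "(kernel_defect b u has_real_derivative kernel_defect' b u r) (at r)"
proof -
  consider "u \<le> 0" | "0 < u" "u < r" | "r < u" "0 < u" using r by linarith
  then show ?thesis
  proof cases
    case 1
    then show ?thesis
      unfolding kernel_defect_def[abs_def] kernel_defect'_def using r
      by (auto intro!: derivative_eq_intros)
  next
    case 2
    define y where "y = (r - u) / u"
    have y: "0 < y" "r - u = u * y" "r / u = 1 + y" using 2 by (auto simp: y_def field_simps)
    have dG: "((\<lambda>y. y powr b * pfaff_form b y - y powr b) has_real_derivative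
        b * y powr (b - 1) * (1 + y) powr b - b * y powr (b - 1)) (at y)"
      using y by (intro DERIV_diff pfaff_form_deriv[OF b] has_real_derivative_powr)
    have dy: "((\<lambda>r. (r - u) / u) has_real_derivative 1 / u) (at r)"
      using 2 by (auto intro!: derivative_eq_intros)
    define G where "G y = y powr b * pfaff_form b y - y powr b" for y
    have "((\<lambda>r. u powr b * G ((r - u) / u)) has_real_derivative
        u powr b * ((b * y powr (b - 1) * (1 + y) powr b - b * y powr (b - 1)) * (1 / u))) (at r)"
      using dG unfolding G_def[symmetric] y_def
      by (intro DERIV_cmult DERIV_chain2[OF _ dy])
    also have "u powr b * ((b * y powr (b - 1) * (1 + y) powr b - b * y powr (b - 1)) * (1 / u))
       = kernel_defect' b u r"
      using 2 y(1) unfolding kernel_defect'_def y(2,3) by (simp add: powr_mult powr_diff field_simps)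
    finally show ?thesis
    proof (rule has_field_derivative_transform_within_open[where S = "{u<..}"])
      fix x assume "x \<in> {u<..}"
      then have "(x - u) powr b = u powr b * ((x - u) / u) powr b"
        using 2 by (simp add: powr_divide)
      then show "u powr b * G ((x - u) / u) = kernel_defect b u x"
        using 2 \<open>x \<in> {u<..}\<close> by (simp add: kernel_defect_def G_def algebra_simps)
    qed (use 2 in auto)
  next
    case 3
    have "((\<lambda>_. 0) has_real_derivative kernel_defect' b u r) (at r)"
      using 3 by (simp add: kernel_defect'_def)
    then show ?thesis
      by (rule has_field_derivative_transform_within_open[where S = "{..<u}"])
        (use 3 in \<open>auto simp: kernel_defect_def\<close>)
  qed
qed

text \<open>For b < 0 and r decreasing to u > 0, both kernels blow up; their leading terms (r - u)^b
  agree and cancel.\<close>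

lemma isCont_kernel_defect:
  assumes b: "\<bar>b\<bar> < 1/2" and r: "0 < r"
  shows "isCont (kernel_defect b u) r"
proof (cases "r = u")
  case False
  then show ?thesis
    using kernel_defect_deriv[OF b r] DERIV_isCont by blast
next
  case True
  then have u: "0 < u" using r by simp
  have "eventually (\<lambda>r. kernel_defect b u r = 0) (at_left u)"
    using u by (auto simp: eventually_at_filter kernel_defect_def)
  then have left: "(kernel_defect b u \<longlongrightarrow> 0) (at_left u)"
    by (rule tendsto_eventually)
  have "filterlim (\<lambda>r. (r - u) / u) (at_right 0) (at_right u)"
    unfolding filterlim_at
  proof
    show "eventually (\<lambda>r. (r - u) / u \<in> {0<..} \<and> (r - u) / u \<noteq> 0) (at_right u)"
      using u by (auto simp: eventually_at_filter)
    show "((\<lambda>r. (r - u) / u) \<longlongrightarrow> 0) (at_right u)"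
      using u by (auto intro!: tendsto_eq_intros)
  qed
  from filterlim_compose[OF pfaff_form_tendsto[OF b] this]
  have "((\<lambda>r. u powr b * (((r - u) / u) powr b * (pfaff_form b ((r - u) / u) - 1))) \<longlongrightarrow> u powr b * 0) (at_right u)"
    by (intro tendsto_mult) auto
  moreover have "eventually (\<lambda>r. u powr b * (((r - u) / u) powr b * (pfaff_form b ((r - u) / u) - 1)) = kernel_defect b u r) (at_right u)"
    using eventually_at_right_less[of u] by eventually_elim (use u in \<open>simp add: kernel_defect_def powr_divide\<close>)
  ultimately have "(kernel_defect b u \<longlongrightarrow> u powr b * 0) (at_right u)"
    by (rule Lim_transform_eventually)
  with left have "(kernel_defect b u \<longlongrightarrow> kernel_defect b u u) (at u)"
    using u by (simp add: filterlim_at_split kernel_defect_def)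
  then show ?thesis
    using True by (simp add: isCont_def)
qed

section \<open>Measurability of the kernel difference and its derivative\<close>

lemma measurable_pfaff_form [measurable]: "pfaff_form b \<in> borel_measurable borel"
  unfolding pfaff_form_def[abs_def] hyp_series_def[abs_def] by measurable

lemma measurable_kernel_defect [measurable]: "(\<lambda>u. kernel_defect b u r) \<in> borel_measurable borel"
  unfolding kernel_defect_def[abs_def] by measurable

lemma measurable_kernel_defect' [measurable]:
  "(\<lambda>(u, r). kernel_defect' b u r) \<in> borel_measurable (borel \<Otimes>\<^sub>M borel)"
  unfolding kernel_defect'_def[abs_def] by measurable

lemma measurable_kernel_defect'_left [measurable]: "(\<lambda>u. kernel_defect' b u r) \<in> borel_measurable borel"
  unfolding kernel_defect'_def[abs_def] by measurable

lemma measurable_kernel_defect'_right [measurable]: "kernel_defect' b u \<in> borel_measurable borel"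
  unfolding kernel_defect'_def[abs_def] by measurable

text \<open>The fundamental theorem only gives a gauge integral, with f' possibly unbounded at the
  points of S. Nonnegativity of f' turns it into a Lebesgue integral without a separate proof of
  integrability.\<close>

lemma square_increment_le:
  fixes f f' :: "real \<Rightarrow> real"
  assumes "x \<le> y" "finite S" "continuous_on {x..y} f"
    and deriv: "\<And>r. r \<in> {x<..<y} - S \<Longrightarrow> (f has_real_derivative f' r) (at r)"
    and nonneg: "\<And>r. r \<in> {x..y} \<Longrightarrow> 0 \<le> f' r"
    and [measurable]: "f' \<in> borel_measurable borel"
  shows "ennreal ((f y - f x)\<^sup>2) \<le> ennreal (y - x) * (\<integral>\<^sup>+r. ennreal ((f' r)\<^sup>2) * indicator {x..y} r \<partial>lborel)"
proof -
  have hi: "(f' has_integral (f y - f x)) {x..y}"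
    using assms by (intro fundamental_theorem_of_calculus_interior_strong[of S])
      (auto simp: has_real_derivative_iff_has_vector_derivative)
  have ge: "0 \<le> f y - f x"
    using has_integral_nonneg[OF hi nonneg] .
  have "ennreal ((f y - f x)\<^sup>2) = (\<integral>\<^sup>+r. ennreal (f' r) * indicator {x..y} r \<partial>lborel)\<^sup>2"
    using nn_integral_has_integral_lebesgue'[OF nonneg hi] ge by (simp add: ennreal_power)
  \<comment> \<open>The indicator is doubled so that Cauchy--Schwarz can be applied to f' and 1 on
    the interval; the second factor gives y - x.\<close>
  also have "\<dots> = (\<integral>\<^sup>+r. (ennreal (f' r) * indicator {x..y} r) * indicator {x..y} r \<partial>lborel)\<^sup>2"
    by (simp add: mult.assoc indicator_inter_arith[symmetric])
  also have "\<dots> \<le> (\<integral>\<^sup>+r. (ennreal (f' r) * indicator {x..y} r)\<^sup>2 \<partial>lborel) * (\<integral>\<^sup>+r. (indicator {x..y} r)\<^sup>2 \<partial>lborel)"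
    by (intro Cauchy_Schwarz_nn_integral) measurable
  also have "(\<integral>\<^sup>+r. (ennreal (f' r) * indicator {x..y} r)\<^sup>2 \<partial>lborel) = (\<integral>\<^sup>+r. ennreal ((f' r)\<^sup>2) * indicator {x..y} r \<partial>lborel)"
    using nonneg by (intro nn_integral_cong) (auto simp: ennreal_power split: split_indicator)
  also have "(\<integral>\<^sup>+r. (indicator {x..y} r)\<^sup>2 \<partial>lborel) = (\<integral>\<^sup>+r. indicator {x..y} r \<partial>lborel)"
    by (intro nn_integral_cong) (auto split: split_indicator)
  also have "\<dots> = ennreal (y - x)"
    using assms(1) by simp
  finally show ?thesis by (simp add: mult.commute)
qed

section \<open>Time increments of the kernel difference\<close>

lemma kernel_defect'_nonneg:
  assumes "0 < u" "\<bar>b\<bar> < 1/2"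
  shows "0 \<le> kernel_defect' b u r"
proof (cases "u < r")
  case True
  have "0 \<le> b * ((r / u) powr b - 1)"
  proof (cases "0 \<le> b")
    case True
    then show ?thesis using \<open>u < r\<close> assms by (simp add: ge_one_powr_ge_zero)
  next
    case False
    have "(r / u) powr b \<le> (r / u) powr 0"
      using False \<open>u < r\<close> assms by (intro powr_mono) auto
    then show ?thesis using False \<open>u < r\<close> assms by (intro mult_nonpos_nonpos) auto
  qed
  then have "0 \<le> (b * ((r / u) powr b - 1)) * (r - u) powr (b - 1)" by simp
  then show ?thesis using assms True by (simp add: kernel_defect'_def mult_ac)
qed (use assms in \<open>simp add: kernel_defect'_def\<close>)

text \<open>For fixed u the derivative does not change sign in r: it is nonnegative for u > 0, and
  for u <= 0 it has the sign of -b. When u <= 0 and b > 0, \<open>square_increment_le\<close> is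
  applied to the negatives.\<close>

lemma kernel_defect_increment:
  assumes b: "\<bar>b\<bar> < 1/2" and xy: "0 < x" "x \<le> y"
  shows "ennreal ((kernel_defect b u y - kernel_defect b u x)\<^sup>2) \<le>
    ennreal (y - x) * (\<integral>\<^sup>+r. ennreal ((kernel_defect' b u r)\<^sup>2) * indicator {x..y} r \<partial>lborel)"
proof -
  have cont: "continuous_on {x..y} (kernel_defect b u)"
    using isCont_kernel_defect[OF b] xy by (intro continuous_at_imp_continuous_on) auto
  have deriv: "(kernel_defect b u has_real_derivative kernel_defect' b u r) (at r)" if "r \<in> {x<..<y} - {u}" for r
    using kernel_defect_deriv[OF b] that xy by auto
  show ?thesis
  proof (cases "0 < u \<or> b \<le> 0")
    case True
    then have "0 \<le> kernel_defect' b u r" if "r \<in> {x..y}" for r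
      using kernel_defect'_nonneg[OF _ b] by (auto simp: kernel_defect'_def mult_nonpos_nonneg)
    then show ?thesis
      using square_increment_le[OF xy(2) _ cont deriv _ measurable_kernel_defect'_right] by blast
  next
    case False
    then have "0 \<le> - kernel_defect' b u r" for r
      by (auto simp: kernel_defect'_def)
    then show ?thesis
      using square_increment_le[of x y "{u}" "\<lambda>r. - kernel_defect b u r" "\<lambda>r. - kernel_defect' b u r"]
        xy cont DERIV_minus[OF deriv] by (simp add: continuous_on_minus power2_commute)
  qed
qed

text \<open>Everything follows from w <= w^|b| <= 1. With w = u/r, the factor (1 - w)^2 compensates
  the singularity (1 - w)^(2b-2) of the squared derivative at u = r.\<close>

lemma powr_minus_one_square_le:
  assumes "\<bar>b\<bar> < 1" "0 < w" "w < (1::real)"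
  shows "((1 / w) powr b - 1)\<^sup>2 \<le> w powr (- 2 * \<bar>b\<bar>) * (1 - w)\<^sup>2"
proof -
  have w: "w \<le> w powr \<bar>b\<bar>" "w powr \<bar>b\<bar> \<le> 1"
    using powr_mono'[of "\<bar>b\<bar>" 1 w] assms by (auto simp: powr_le1)
  have "\<bar>(1 / w) powr b - 1\<bar> \<le> w powr (- \<bar>b\<bar>) * (1 - w)"
  proof (cases "0 \<le> b")
    case True
    have "(1 / w) powr b - 1 = w powr (-\<bar>b\<bar>) * (1 - w powr \<bar>b\<bar>)"
      using True assms by (simp add: powr_divide powr_minus field_simps)
    moreover have "\<dots> \<le> w powr (-\<bar>b\<bar>) * (1 - w)"
      using w by (intro mult_left_mono) auto
    moreover have "0 \<le> w powr (-\<bar>b\<bar>) * (1 - w powr \<bar>b\<bar>)"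
      using w by auto
    ultimately show ?thesis by linarith
  next
    case False
    have "(1 / w) powr b = w powr \<bar>b\<bar>"
      using False assms by (simp add: powr_divide powr_minus field_simps)
    moreover have "1 * (1 - w) \<le> w powr (-\<bar>b\<bar>) * (1 - w)"
      using w assms by (intro mult_right_mono) (auto simp: powr_minus field_simps)
    ultimately show ?thesis using w by simp
  qed
  then have "((1 / w) powr b - 1)\<^sup>2 \<le> (w powr (- \<bar>b\<bar>) * (1 - w))\<^sup>2"
    by (rule abs_le_square_iff[THEN iffD1, OF order_trans]) simp
  also have "\<dots> = w powr (- 2 * \<bar>b\<bar>) * (1 - w)\<^sup>2"
    using assms by (simp add: power_mult_distrib flip: powr_add) (simp add: power2_eq_square flip: powr_add)
  finally show ?thesis .
qed

text \<open>The reflection u = -x leaves the integral of b^2 (r + x)^(2b-2) over x >= 0, which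
  converges because b < 1/2.\<close>

lemma nn_integral_kernel_defect'_neg:
  assumes b: "\<bar>b\<bar> < 1/2" and r: "0 < r"
  shows "(\<integral>\<^sup>+u. ennreal ((kernel_defect' b u r)\<^sup>2) * indicator {..0} u \<partial>lborel)
    = ennreal (b\<^sup>2 / (1 - 2 * b) * r powr (2 * b - 1))"
proof -
  define g where "g x = b\<^sup>2 * (r + x) powr (2 * b - 2)" for x
  define F where "F x = b\<^sup>2 / (2 * b - 1) * (r + x) powr (2 * b - 1)" for x
  have bb: "2 * b - 1 < 0" using b by linarith
  have "(\<integral>\<^sup>+u. ennreal ((kernel_defect' b u r)\<^sup>2) * indicator {..0} u \<partial>lborel)
      = (\<integral>\<^sup>+x. ennreal ((kernel_defect' b (- x) r)\<^sup>2) * indicator {..0} (- x) \<partial>lborel)"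
    by (subst nn_integral_real_affine[where c = "-1" and t = 0]) auto
  also have "\<dots> = (\<integral>\<^sup>+x. ennreal (g x) * indicator {0..} x \<partial>lborel)"
  proof (intro nn_integral_cong)
    fix x :: real
    have "((r + x) powr (b - 1))\<^sup>2 = (r + x) powr (2 * b - 2)"
      by (simp add: power2_eq_square flip: powr_add)
    then show "ennreal ((kernel_defect' b (- x) r)\<^sup>2) * indicator {..0} (- x) = ennreal (g x) * indicator {0..} x"
      by (auto simp: kernel_defect'_def g_def power_mult_distrib split: split_indicator)
  qed
  also have "\<dots> = ennreal (0 - F 0)"
  proof (rule nn_integral_FTC_atLeast)
    show "(F has_real_derivative g x) (at x)" if "0 \<le> x" for x
      unfolding F_def g_def using that r bb
      by (auto intro!: derivative_eq_intros)
    have "((\<lambda>x. (r + x) powr (2 * b - 1)) \<longlongrightarrow> 0) at_top"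
      by (intro tendsto_neg_powr bb filterlim_tendsto_add_at_top[OF tendsto_const filterlim_ident])
    then show "(F \<longlongrightarrow> 0) at_top"
      unfolding F_def by (rule tendsto_mult_right_zero)
  qed (auto simp: g_def[abs_def])
  also have "0 - F 0 = b\<^sup>2 / (1 - 2 * b) * r powr (2 * b - 1)"
    using bb by (simp add: F_def field_simps)
  finally show ?thesis .
qed

text \<open>Substituting u = r w extracts r * r^(2b-2). By \<open>powr_minus_one_square_le\<close>
  the rest is at most b^2 w^(-2|b|) (1 - w)^(2b), a Beta integrand with parameters p = 1 - 2|b| and
  q = 1 + 2b, both positive.\<close>

lemma nn_integral_kernel_defect'_pos:
  assumes b: "\<bar>b\<bar> < 1/2" and r: "0 < r"
  shows "(\<integral>\<^sup>+u. ennreal ((kernel_defect' b u r)\<^sup>2) * indicator {0<..} u \<partial>lborel)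
    \<le> ennreal (b\<^sup>2 * Beta (1 - 2 * \<bar>b\<bar>) (1 + 2 * b) * r powr (2 * b - 1))"
proof -
  define p where "p = 1 - 2 * \<bar>b\<bar>"
  define q where "q = 1 + 2 * b"
  have pq: "0 < p" "0 < q" using b by (auto simp: p_def q_def abs_less_iff)
  define g where "g w = w powr (p - 1) * (1 - w) powr (q - 1)" for w
  have "(\<integral>\<^sup>+u. ennreal ((kernel_defect' b u r)\<^sup>2) * indicator {0<..} u \<partial>lborel)
      = ennreal r * (\<integral>\<^sup>+w. ennreal ((kernel_defect' b (r * w) r)\<^sup>2) * indicator {0<..} (r * w) \<partial>lborel)"
    using r by (subst nn_integral_real_affine[where c = r and t = 0]) auto
  also have "\<dots> \<le> ennreal r * (\<integral>\<^sup>+w. ennreal (b\<^sup>2 * r powr (2 * b - 2)) * (ennreal (g w) * indicator {0..1} w) \<partial>lborel)"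
  proof (intro mult_left_mono nn_integral_mono)
    fix w :: real
    show "ennreal ((kernel_defect' b (r * w) r)\<^sup>2) * indicator {0<..} (r * w)
      \<le> ennreal (b\<^sup>2 * r powr (2 * b - 2)) * (ennreal (g w) * indicator {0..1} w)"
    proof (cases "0 < w \<and> w < 1")
      case True
      have e: "r - r * w = r * (1 - w)" "r / (r * w) = 1 / w" using r by (auto simp: algebra_simps)
      have "((r * (1 - w)) powr (b - 1))\<^sup>2 = r powr (2 * b - 2) * (1 - w) powr (2 * b - 2)"
        using r True by (simp add: powr_mult power_mult_distrib) (simp add: power2_eq_square flip: powr_add)
      then have "(kernel_defect' b (r * w) r)\<^sup>2
          = b\<^sup>2 * r powr (2 * b - 2) * ((1 - w) powr (2 * b - 2) * ((1 / w) powr b - 1)\<^sup>2)"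
        using True r by (simp add: kernel_defect'_def mult_le_0_iff e power_mult_distrib)
      also have "\<dots> \<le> b\<^sup>2 * r powr (2 * b - 2) * ((1 - w) powr (2 * b - 2) * (w powr (- 2 * \<bar>b\<bar>) * (1 - w)\<^sup>2))"
        using True b by (intro mult_left_mono powr_minus_one_square_le) auto
      also have "(1 - w) powr (2 * b - 2) * (w powr (- 2 * \<bar>b\<bar>) * (1 - w)\<^sup>2) = g w"
      proof -
        have "(1 - w)\<^sup>2 = (1 - w) powr 2" using True by simp
        then have "(1 - w) powr (2 * b - 2) * (1 - w)\<^sup>2 = (1 - w) powr (2 * b)"
          by (simp only: flip: powr_add) simp
        then show ?thesis by (simp add: g_def p_def q_def)
      qed
      finally have "ennreal ((kernel_defect' b (r * w) r)\<^sup>2) \<le> ennreal (b\<^sup>2 * r powr (2 * b - 2) * g w)"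
        by (rule ennreal_leI)
      then show ?thesis
        using True r by (simp add: g_def ennreal_mult')
    next
      case False
      then show ?thesis
        using r by (auto simp: kernel_defect'_def zero_less_mult_iff mult_le_0_iff split: split_indicator)
    qed
  qed auto
  also have "\<dots> = ennreal r * (ennreal (b\<^sup>2 * r powr (2 * b - 2)) * ennreal (Beta p q))"
  proof -
    have [measurable]: "g \<in> borel_measurable borel" unfolding g_def[abs_def] by measurable
    have "(\<integral>\<^sup>+w. ennreal (g w) * indicator {0..1} w \<partial>lborel) = ennreal (Beta p q)"
      using nn_integral_has_integral_lebesgue'[OF _ has_integral_Beta_real[OF pq]] by (simp add: g_def)
    then show ?thesis by (subst nn_integral_cmult) auto
  qed
  also have "\<dots> = ennreal (r * (b\<^sup>2 * r powr (2 * b - 2) * Beta p q))"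
    using r by (simp flip: ennreal_mult')
  also have "r * (b\<^sup>2 * r powr (2 * b - 2) * Beta p q) = b\<^sup>2 * Beta p q * (r powr 1 * r powr (2 * b - 2))"
    using r by simp
  also have "r powr 1 * r powr (2 * b - 2) = r powr (2 * b - 1)"
    unfolding powr_add[symmetric] by simp
  finally show ?thesis by (simp add: p_def q_def)
qed

text \<open>The contributions of the half-lines u <= 0 and u > 0, in this order.\<close>

definition defect_const :: "real \<Rightarrow> real" where
  "defect_const b = b\<^sup>2 / (1 - 2 * b) + b\<^sup>2 * Beta (1 - 2 * \<bar>b\<bar>) (1 + 2 * b)"

lemma defect_const_nonneg:
  assumes "\<bar>b\<bar> < 1/2"
  shows "0 \<le> defect_const b"
proof -
  have "0 < 1 - 2 * \<bar>b\<bar>" "0 < 1 + 2 * b" "0 < 1 - 2 * b"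
    using assms by linarith+
  then show ?thesis
    by (auto simp: defect_const_def Beta_def intro!: add_nonneg_nonneg mult_nonneg_nonneg divide_nonneg_nonneg Gamma_real_nonneg)
qed

lemma nn_integral_kernel_defect':
  assumes b: "\<bar>b\<bar> < 1/2" and r: "0 < r"
  shows "(\<integral>\<^sup>+u. ennreal ((kernel_defect' b u r)\<^sup>2) \<partial>lborel)
    \<le> ennreal (defect_const b * r powr (2 * b - 1))"
proof -
  have "(\<integral>\<^sup>+u. ennreal ((kernel_defect' b u r)\<^sup>2) \<partial>lborel)
     = (\<integral>\<^sup>+u. ennreal ((kernel_defect' b u r)\<^sup>2) * indicator {..0} u
         + ennreal ((kernel_defect' b u r)\<^sup>2) * indicator {0<..} u \<partial>lborel)"
    by (intro nn_integral_cong) (auto split: split_indicator)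
  also have "\<dots> = (\<integral>\<^sup>+u. ennreal ((kernel_defect' b u r)\<^sup>2) * indicator {..0} u \<partial>lborel)
         + (\<integral>\<^sup>+u. ennreal ((kernel_defect' b u r)\<^sup>2) * indicator {0<..} u \<partial>lborel)"
    by (intro nn_integral_add) auto
  also have "\<dots> \<le> ennreal (b\<^sup>2 / (1 - 2 * b) * r powr (2 * b - 1))
      + ennreal (b\<^sup>2 * Beta (1 - 2 * \<bar>b\<bar>) (1 + 2 * b) * r powr (2 * b - 1))"
    using nn_integral_kernel_defect'_pos[OF b r] nn_integral_kernel_defect'_neg[OF b r]
    by (simp add: add_left_mono)
  also have "\<dots> = ennreal (defect_const b * r powr (2 * b - 1))"
  proof -
    have "0 < 1 - 2 * \<bar>b\<bar>" "0 < 1 + 2 * b" "0 < 1 - 2 * b"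
      using b by linarith+
    then show ?thesis
      by (subst ennreal_plus[symmetric])
        (auto simp: defect_const_def Beta_def algebra_simps intro!: mult_nonneg_nonneg divide_nonneg_nonneg Gamma_real_nonneg)
  qed
  finally show ?thesis .
qed

text \<open>One factor y - x comes from Cauchy--Schwarz, the other from the outer integral over r
  after Tonelli. As 2b - 1 < 0, the bound r^(2b-1) is largest at r = x.\<close>

lemma nn_integral_kernel_defect_increment:
  assumes b: "\<bar>b\<bar> < 1/2" and xy: "0 < x" "x \<le> y"
  shows "(\<integral>\<^sup>+u. ennreal ((kernel_defect b u y - kernel_defect b u x)\<^sup>2) \<partial>lborel)
    \<le> ennreal ((y - x)\<^sup>2 * defect_const b * x powr (2 * b - 1))"
proof -
  define K where "K = defect_const b * x powr (2 * b - 1)"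
  have K: "0 \<le> K" using defect_const_nonneg[OF b] by (simp add: K_def)
  have [measurable]: "(\<lambda>p. kernel_defect' b (fst p) (snd p)) \<in> borel_measurable (borel \<Otimes>\<^sub>M borel)"
    using measurable_kernel_defect'[of b] by (simp add: case_prod_beta)
  have [measurable]: "(\<lambda>(u, r). ennreal ((kernel_defect' b u r)\<^sup>2) * indicator {x..y} r) \<in> borel_measurable (lborel \<Otimes>\<^sub>M lborel)"
    by (simp add: case_prod_beta)
  have "(\<integral>\<^sup>+u. ennreal ((kernel_defect b u y - kernel_defect b u x)\<^sup>2) \<partial>lborel)
     \<le> (\<integral>\<^sup>+u. ennreal (y - x) * (\<integral>\<^sup>+r. ennreal ((kernel_defect' b u r)\<^sup>2) * indicator {x..y} r \<partial>lborel) \<partial>lborel)"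
    by (intro nn_integral_mono kernel_defect_increment b xy)
  also have "\<dots> = ennreal (y - x) * (\<integral>\<^sup>+u. (\<integral>\<^sup>+r. ennreal ((kernel_defect' b u r)\<^sup>2) * indicator {x..y} r \<partial>lborel) \<partial>lborel)"
    by (intro nn_integral_cmult) measurable
  also have "\<dots> \<le> ennreal (y - x) * (ennreal K * ennreal (y - x))"
  proof (rule mult_left_mono)
    have "(\<integral>\<^sup>+u. (\<integral>\<^sup>+r. ennreal ((kernel_defect' b u r)\<^sup>2) * indicator {x..y} r \<partial>lborel) \<partial>lborel)
      = (\<integral>\<^sup>+r. (\<integral>\<^sup>+u. ennreal ((kernel_defect' b u r)\<^sup>2) * indicator {x..y} r \<partial>lborel) \<partial>lborel)"
      by (intro lborel_pair.Fubini'[symmetric]) measurable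
    also have "\<dots> \<le> (\<integral>\<^sup>+r. ennreal K * indicator {x..y} r \<partial>lborel)"
    proof (intro nn_integral_mono)
      fix r :: real
      show "(\<integral>\<^sup>+u. ennreal ((kernel_defect' b u r)\<^sup>2) * indicator {x..y} r \<partial>lborel) \<le> ennreal K * indicator {x..y} r"
      proof (cases "r \<in> {x..y}")
        case True
        have "r powr (2 * b - 1) \<le> x powr (2 * b - 1)"
          using True b xy by (intro powr_mono2') auto
        then have "defect_const b * r powr (2 * b - 1) \<le> K"
          unfolding K_def using defect_const_nonneg[OF b] by (intro mult_left_mono)
        then show ?thesis
          using nn_integral_kernel_defect'[OF b, of r] True xy by (auto intro: order_trans ennreal_leI)
      qed simp
    qed
    also have "\<dots> = ennreal K * ennreal (y - x)"
      using xy by (subst nn_integral_cmult) auto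
    finally show "(\<integral>\<^sup>+u. (\<integral>\<^sup>+r. ennreal ((kernel_defect' b u r)\<^sup>2) * indicator {x..y} r \<partial>lborel) \<partial>lborel)
        \<le> ennreal K * ennreal (y - x)" .
  qed simp
  also have "\<dots> = ennreal ((y - x)\<^sup>2 * defect_const b * x powr (2 * b - 1))"
    using xy K by (simp add: K_def power2_eq_square ennreal_mult'[symmetric] mult_ac)
  finally show ?thesis .
qed

lemma nn_integral_kernel_difference:
  fixes H s t :: real
  assumes H: "0 < H" "H < 1" and s: "2 * \<bar>t\<bar> < s"
  shows "(\<integral>\<^sup>+v. ennreal ((indicator {-s..t} v * z_H H (t + s) (v + s)
            - indicator {-s..0} v * z_H H s (v + s)
            - c_H H * (pos_pow (t - v) (H - 1/2) - pos_pow (- v) (H - 1/2)))\<^sup>2) \<partial>lborel)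
    \<le> ennreal ((c_H H)\<^sup>2 * t\<^sup>2 * defect_const (H - 1/2) * (1/2) powr (2 * H - 2) * s powr (2 * H - 2))"
proof -
  define b where "b = H - 1/2"
  have b: "\<bar>b\<bar> < 1/2" using H unfolding b_def by linarith
  \<comment> \<open>Since t may be negative, the times s and t + s are put in order; the square is
    the same either way.\<close>
  define x where "x = min s (t + s)"
  define y where "y = max s (t + s)"
  have xy: "0 < x" "x \<le> y" "s / 2 \<le> x" "(y - x)\<^sup>2 = t\<^sup>2" "0 < s" "0 < t + s"
    using s by (auto simp: x_def y_def min_def max_def power2_commute)
  define g where "g u = ennreal ((kernel_defect b u (t + s) - kernel_defect b u s)\<^sup>2)" for u
  have [measurable]: "g \<in> borel_measurable borel" unfolding g_def[abs_def] by measurable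
  have "(indicator {-s..t} v * z_H H (t + s) (v + s) - indicator {-s..0} v * z_H H s (v + s)
            - c_H H * (pos_pow (t - v) (H - 1/2) - pos_pow (- v) (H - 1/2)))
     = c_H H * (kernel_defect b (v + s) (t + s) - kernel_defect b (v + s) s)" for v
  proof -
    have i: "indicator {-s..t} v * z_H H (t + s) (v + s) = z_H H (t + s) (v + s)"
      "indicator {-s..0} v * z_H H s (v + s) = z_H H s (v + s)"
      by (auto simp: z_H_def split: split_indicator)
    show ?thesis
      unfolding i
      using z_H_eq_kernel_defect[OF H xy(6), of "v + s"] z_H_eq_kernel_defect[OF H xy(5), of "v + s"]
      by (simp add: b_def algebra_simps)
  qed
  then have "(\<integral>\<^sup>+v. ennreal ((indicator {-s..t} v * z_H H (t + s) (v + s)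
            - indicator {-s..0} v * z_H H s (v + s)
            - c_H H * (pos_pow (t - v) (H - 1/2) - pos_pow (- v) (H - 1/2)))\<^sup>2) \<partial>lborel)
     = (\<integral>\<^sup>+v. ennreal ((c_H H)\<^sup>2) * g (s + 1 * v) \<partial>lborel)"
    by (simp add: g_def power_mult_distrib ennreal_mult' add.commute)
  also have "\<dots> = ennreal ((c_H H)\<^sup>2) * (\<integral>\<^sup>+v. g (s + 1 * v) \<partial>lborel)"
    by (intro nn_integral_cmult) measurable
  also have "(\<integral>\<^sup>+v. g (s + 1 * v) \<partial>lborel) = (\<integral>\<^sup>+u. g u \<partial>lborel)"
    using nn_integral_real_affine[of g 1 s] by simp
  also have "\<dots> = (\<integral>\<^sup>+u. ennreal ((kernel_defect b u y - kernel_defect b u x)\<^sup>2) \<partial>lborel)"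
    by (intro nn_integral_cong) (auto simp: g_def x_def y_def min_def max_def power2_commute)
  also have "ennreal ((c_H H)\<^sup>2) * \<dots> \<le> ennreal ((c_H H)\<^sup>2) * ennreal (t\<^sup>2 * defect_const b * ((1/2) powr (2 * H - 2) * s powr (2 * H - 2)))"
  proof (intro mult_left_mono order_trans[OF nn_integral_kernel_defect_increment[OF b xy(1,2)]] ennreal_leI)
    \<comment> \<open>The condition s > 2|t| keeps both times above s/2. The negative exponent turns
      this into the factor (1/2)^(2H-2).\<close>
    have "x powr (2 * b - 1) \<le> (s / 2) powr (2 * b - 1)"
      using xy b by (intro powr_mono2') auto
    also have "\<dots> = (1/2) powr (2 * H - 2) * s powr (2 * H - 2)"
      using xy by (simp add: b_def powr_mult[symmetric])
    finally show "(y - x)\<^sup>2 * defect_const b * x powr (2 * b - 1) \<le> t\<^sup>2 * defect_const b * ((1/2) powr (2 * H - 2) * s powr (2 * H - 2))"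
      unfolding xy(4) using defect_const_nonneg[OF b] by (intro mult_left_mono) auto
  qed simp
  also have "\<dots> = ennreal ((c_H H)\<^sup>2 * t\<^sup>2 * defect_const (H - 1/2) * (1/2) powr (2 * H - 2) * s powr (2 * H - 2))"
    by (simp add: b_def ennreal_mult'[symmetric] mult_ac)
  finally show ?thesis .
qed

subsection \<open>Additive functions and square integrability\<close>

lemma additive_mult_nat:
  fixes f :: "real \<Rightarrow> real"
  assumes add: "\<And>s t. 0 \<le> s \<Longrightarrow> 0 \<le> t \<Longrightarrow> f (s + t) = f s + f t" and "0 \<le> x"
  shows "f (real n * x) = real n * f x"
proof (induction n)
  case 0
  show ?case using add[of 0 0] by simp
next
  case (Suc n)
  have "f (real (Suc n) * x) = f (real n * x + x)" by (simp add: algebra_simps)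
  also have "\<dots> = f (real n * x) + f x" using assms by (intro add) auto
  finally show ?case using Suc by (simp add: algebra_simps)
qed

lemma real_le_zero_of_bounded_multiples:
  fixes x B :: real
  assumes "\<And>n::nat. real n * x \<le> B"
  shows "x \<le> 0"
proof (rule ccontr)
  assume "\<not> x \<le> 0"
  then obtain n :: nat where "B < real n * x"
    using reals_Archimedean3[of x] by auto
  then show False using assms[of n] by simp
qed

text \<open>Nonnegativity makes f monotone. With k the integer part of n t, both n f(t) and n t f(1)
  lie between k f(1) and (k + 1) f(1), so n |f(t) - t f(1)| stays bounded in n. The lemma serves the
  variance.\<close>

lemma additive_nonneg_linear:
  fixes f :: "real \<Rightarrow> real"
  assumes add: "\<And>s t. 0 \<le> s \<Longrightarrow> 0 \<le> t \<Longrightarrow> f (s + t) = f s + f t"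
    and nonneg: "\<And>t. 0 \<le> t \<Longrightarrow> 0 \<le> f t" and t: "0 \<le> t"
  shows "f t = t * f 1"
proof -
  have mono: "f x \<le> f y" if "0 \<le> x" "x \<le> y" for x y
    using add[of x "y - x"] nonneg[of "y - x"] that by simp
  have "real n * \<bar>f t - t * f 1\<bar> \<le> f 1" for n :: nat
  proof -
    define k where "k = nat \<lfloor>real n * t\<rfloor>"
    have k: "real k \<le> real n * t" "real n * t \<le> real (Suc k)"
      using t unfolding k_def by (auto simp: of_nat_nat) linarith+
    have "real k * f 1 \<le> real n * f t" "real n * f t \<le> real (Suc k) * f 1"
      using mono[of "real k * 1" "real n * t"] mono[of "real n * t" "real (Suc k) * 1"] k t
        additive_mult_nat[of f, OF add, of t n] additive_mult_nat[of f, OF add, of 1 k]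
        additive_mult_nat[of f, OF add, of 1 "Suc k"] by auto
    moreover have "real k * f 1 \<le> (real n * t) * f 1" "(real n * t) * f 1 \<le> real (Suc k) * f 1"
      using k nonneg[of 1] by (intro mult_right_mono; simp)+
    moreover have "real (Suc k) * f 1 = real k * f 1 + f 1" by (simp add: algebra_simps)
    ultimately have "\<bar>real n * f t - (real n * t) * f 1\<bar> \<le> f 1" by linarith
    also have "real n * f t - (real n * t) * f 1 = real n * (f t - t * f 1)" by (simp add: algebra_simps)
    finally show ?thesis by (simp add: abs_mult)
  qed
  then have "\<bar>f t - t * f 1\<bar> \<le> 0" by (rule real_le_zero_of_bounded_multiples)
  then show ?thesis by simp
qed

text \<open>A bound near 0 extends to [0, 1) by dividing the argument by N. Since f vanishes at
  integers, f(n t) depends only on the fractional part of n t, so n |f(t)| stays bounded. The lemma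
  serves the mean, for which no sign is available.\<close>

lemma additive_bounded_zero:
  fixes f :: "real \<Rightarrow> real"
  assumes add: "\<And>s t. 0 \<le> s \<Longrightarrow> 0 \<le> t \<Longrightarrow> f (s + t) = f s + f t"
    and f1: "f 1 = 0" and d: "0 < d" and bd: "\<And>h. 0 < h \<Longrightarrow> h < d \<Longrightarrow> \<bar>f h\<bar> \<le> B" and t: "0 \<le> t"
  shows "f t = 0"
proof -
  have f0: "f 0 = 0" using add[of 0 0] by simp
  have B: "0 \<le> B" using bd[of "d/2"] d by auto
  obtain N :: nat where N: "1 < real N * d" using reals_Archimedean3[OF d] by auto
  then have N0: "0 < real N" using d by (cases N) auto
  have bd1: "\<bar>f x\<bar> \<le> real N * B" if "0 \<le> x" "x < 1" for x
  proof (cases "x = 0")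
    case True
    then show ?thesis using f0 B by simp
  next
    case False
    have "x / real N < d" using that N N0 by (simp add: field_simps)
    then have "\<bar>f (x / real N)\<bar> \<le> B" using False that N0 by (intro bd) auto
    moreover have "f x = real N * f (x / real N)"
      using additive_mult_nat[of f, OF add, of "x / real N" N] that N0 by simp
    ultimately show ?thesis using N0 by (simp add: abs_mult)
  qed
  have "real n * \<bar>f t\<bar> \<le> real N * B" for n :: nat
  proof -
    define k where "k = nat \<lfloor>real n * t\<rfloor>"
    have k: "real k \<le> real n * t" "real n * t - real k < 1"
      using t unfolding k_def by (auto simp: of_nat_nat) linarith
    have "f (real n * t) = f (real k * 1 + (real n * t - real k))" by simp
    also have "\<dots> = f (real k * 1) + f (real n * t - real k)" using k by (intro add) auto
    also have "f (real k * 1) = 0" using additive_mult_nat[of f, OF add, of 1 k] f1 by simp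
    finally have "\<bar>real n * f t\<bar> \<le> real N * B"
      using bd1[of "real n * t - real k"] k additive_mult_nat[of f, OF add, of t n] t by simp
    then show ?thesis by (simp add: abs_mult)
  qed
  then have "\<bar>f t\<bar> \<le> 0" by (rule real_le_zero_of_bounded_multiples)
  then show ?thesis by simp
qed

section \<open>Square integrability of sums, products and independent summands\<close>

lemma integrable_sq_add:
  fixes A B :: "'a \<Rightarrow> real"
  assumes [measurable]: "A \<in> borel_measurable M" "B \<in> borel_measurable M"
    and "integrable M (\<lambda>\<omega>. (A \<omega>)\<^sup>2)" "integrable M (\<lambda>\<omega>. (B \<omega>)\<^sup>2)"
  shows "integrable M (\<lambda>\<omega>. (A \<omega> + B \<omega>)\<^sup>2)"
proof (rule Bochner_Integration.integrable_bound)
  show "integrable M (\<lambda>\<omega>. 2 * (A \<omega>)\<^sup>2 + 2 * (B \<omega>)\<^sup>2)" using assms by auto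
  have "(x + y)\<^sup>2 \<le> 2 * x\<^sup>2 + 2 * y\<^sup>2" for x y :: real
    using zero_le_power2[of "x - y"] by (simp add: power2_eq_square algebra_simps)
  then show "AE \<omega> in M. norm ((A \<omega> + B \<omega>)\<^sup>2) \<le> norm (2 * (A \<omega>)\<^sup>2 + 2 * (B \<omega>)\<^sup>2)"
    by auto
qed simp

lemma integrable_mult_of_sq:
  fixes A B :: "'a \<Rightarrow> real"
  assumes [measurable]: "A \<in> borel_measurable M" "B \<in> borel_measurable M"
    and "integrable M (\<lambda>\<omega>. (A \<omega>)\<^sup>2)" "integrable M (\<lambda>\<omega>. (B \<omega>)\<^sup>2)"
  shows "integrable M (\<lambda>\<omega>. A \<omega> * B \<omega>)"
proof (rule Bochner_Integration.integrable_bound)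
  show "integrable M (\<lambda>\<omega>. (A \<omega>)\<^sup>2 + (B \<omega>)\<^sup>2)" using assms by auto
  have "\<bar>x * y\<bar> \<le> x\<^sup>2 + y\<^sup>2" for x y :: real
  proof -
    have "0 \<le> (\<bar>x\<bar> - \<bar>y\<bar>)\<^sup>2" by simp
    then have "2 * (\<bar>x\<bar> * \<bar>y\<bar>) \<le> x\<^sup>2 + y\<^sup>2" by (simp add: power2_diff)
    moreover have "0 \<le> \<bar>x\<bar> * \<bar>y\<bar>" by simp
    ultimately show ?thesis unfolding abs_mult by linarith
  qed
  then show "AE \<omega> in M. norm (A \<omega> * B \<omega>) \<le> norm ((A \<omega>)\<^sup>2 + (B \<omega>)\<^sup>2)"
    by auto
qed simp

text \<open>By Fubini, \<open>A + y\<close> is square integrable for some constant \<open>y\<close>.\<close>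

lemma (in prob_space) indep_summand_sq_integrable:
  fixes A B :: "'a \<Rightarrow> real"
  assumes ind: "indep_var borel A borel B" and sq: "integrable M (\<lambda>\<omega>. (A \<omega> + B \<omega>)\<^sup>2)"
  shows "integrable M (\<lambda>\<omega>. (A \<omega>)\<^sup>2)"
proof -
  have [measurable]: "random_variable borel A" "random_variable borel B"
    using indep_var_rv1[OF ind] indep_var_rv2[OF ind] .
  interpret PA: prob_space "distr M borel A" by (rule prob_space_distr) measurable
  interpret PB: prob_space "distr M borel B" by (rule prob_space_distr) measurable
  interpret P: pair_sigma_finite "distr M borel A" "distr M borel B" ..
  have "(\<integral>\<^sup>+ y. (\<integral>\<^sup>+ x. ennreal ((x + y)\<^sup>2) \<partial>distr M borel A) \<partial>distr M borel B)
     = (\<integral>\<^sup>+ p. ennreal ((fst p + snd p)\<^sup>2) \<partial>(distr M borel A \<Otimes>\<^sub>M distr M borel B))"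
    by (subst P.nn_integral_snd[symmetric]) (auto simp: case_prod_beta)
  also have "\<dots> = (\<integral>\<^sup>+ \<omega>. ennreal ((A \<omega> + B \<omega>)\<^sup>2) \<partial>M)"
    using ind unfolding indep_var_distribution_eq by (auto simp: nn_integral_distr)
  also have "\<dots> < \<infinity>"
    using sq by (simp add: integrable_iff_bounded)
  finally have "AE y in distr M borel B. (\<integral>\<^sup>+ x. ennreal ((x + y)\<^sup>2) \<partial>distr M borel A) \<noteq> \<infinity>"
    by (intro nn_integral_PInf_AE) auto
  then have "\<exists>y. (\<integral>\<^sup>+ x. ennreal ((x + y)\<^sup>2) \<partial>distr M borel A) \<noteq> \<infinity>"
    by (rule eventually_happens'[OF PB.ae_filter_bot])
  then obtain y where y: "(\<integral>\<^sup>+ x. ennreal ((x + y)\<^sup>2) \<partial>distr M borel A) \<noteq> \<infinity>" by blast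
  then have "integrable M (\<lambda>\<omega>. (A \<omega> + y)\<^sup>2)"
    by (simp add: integrable_iff_bounded nn_integral_distr less_top)
  from integrable_sq_add[OF _ _ this, of "\<lambda>_. - y"]
  show ?thesis by simp
qed

subsection \<open>Centred square integrable Levy processes\<close>

text \<open>Moments are prescribed at time 1 only. Those at other times have to be derived from
  independence and stationarity of increments and from stochastic continuity.\<close>

locale centered_levy = prob_space M for M :: "'a measure" +
  fixes X :: "real \<Rightarrow> 'a \<Rightarrow> real"
  assumes levy: "levy_process M X"
    and mean_one: "expectation (X 1) = 0"
    and sq_one: "integrable M (\<lambda>\<omega>. (X 1 \<omega>)\<^sup>2)"
begin

lemma rv [measurable]: "0 \<le> t \<Longrightarrow> X t \<in> borel_measurable M"
  using levy by (simp add: levy_process_def)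

lemma AE_zero: "AE \<omega> in M. X 0 \<omega> = 0"
  using levy by (simp add: levy_process_def)

lemma increment_distr:
  "0 \<le> s \<Longrightarrow> s \<le> t \<Longrightarrow> distr M borel (\<lambda>\<omega>. X t \<omega> - X s \<omega>) = distr M borel (X (t - s))"
  using levy unfolding levy_process_def by blast

lemma increment_indep:
  assumes "0 \<le> r" "r \<le> s" "s \<le> t"
  shows "indep_var borel (\<lambda>\<omega>. X s \<omega> - X r \<omega>) borel (\<lambda>\<omega>. X t \<omega> - X s \<omega>)"
proof -
  define \<tau> where "\<tau> i = (if i = 0 then r else if i = 1 then s else t)" for i :: nat
  define Y where "Y = (\<lambda>i \<omega>. X (\<tau> (Suc i)) \<omega> - X (\<tau> i) \<omega>)"
  have "indep_vars (\<lambda>_. borel) Y {..<2}"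
  proof -
    have "\<forall>i<2. 0 \<le> \<tau> i \<and> \<tau> i \<le> \<tau> (Suc i)"
      using assms by (auto simp: \<tau>_def)
    then show ?thesis
      using levy unfolding levy_process_def Y_def by blast
  qed
  \<comment> \<open>Grouping the family into the blocks {0} and {1} gives independent restrictions
    in product spaces; projecting to the coordinates recovers the two increments.\<close>
  then have "indep_var (Pi\<^sub>M {0} (\<lambda>_. borel)) (\<lambda>\<omega>. restrict (\<lambda>i. Y i \<omega>) {0})
       (Pi\<^sub>M {1} (\<lambda>_. borel)) (\<lambda>\<omega>. restrict (\<lambda>i. Y i \<omega>) {1})"
    by (rule indep_var_restrict) auto
  then have "indep_var borel ((\<lambda>f. f 0) \<circ> (\<lambda>\<omega>. restrict (\<lambda>i. Y i \<omega>) {0}))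
       borel ((\<lambda>f. f 1) \<circ> (\<lambda>\<omega>. restrict (\<lambda>i. Y i \<omega>) {1}))"
    by (rule indep_var_compose) auto
  then show ?thesis by (simp add: comp_def Y_def \<tau>_def)
qed

lemma integrable_sq_increment_iff:
  assumes "0 \<le> s" "s \<le> t"
  shows "integrable M (\<lambda>\<omega>. (X t \<omega> - X s \<omega>)\<^sup>2) \<longleftrightarrow> integrable M (\<lambda>\<omega>. (X (t - s) \<omega>)\<^sup>2)"
proof -
  have "integrable M (\<lambda>\<omega>. (X t \<omega> - X s \<omega>)\<^sup>2) \<longleftrightarrow> integrable (distr M borel (\<lambda>\<omega>. X t \<omega> - X s \<omega>)) (\<lambda>x. x\<^sup>2)"
    using assms by (subst integrable_distr_eq) auto
  also have "\<dots> \<longleftrightarrow> integrable M (\<lambda>\<omega>. (X (t - s) \<omega>)\<^sup>2)"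
    using assms by (subst increment_distr) (auto simp: integrable_distr_eq)
  finally show ?thesis .
qed

lemma integral_sq_increment:
  assumes "0 \<le> s" "s \<le> t"
  shows "expectation (\<lambda>\<omega>. (X t \<omega> - X s \<omega>)\<^sup>2) = expectation (\<lambda>\<omega>. (X (t - s) \<omega>)\<^sup>2)"
proof -
  have "expectation (\<lambda>\<omega>. (X t \<omega> - X s \<omega>)\<^sup>2) = (\<integral>x. x\<^sup>2 \<partial>distr M borel (\<lambda>\<omega>. X t \<omega> - X s \<omega>))"
    using assms by (subst integral_distr) auto
  also have "\<dots> = expectation (\<lambda>\<omega>. (X (t - s) \<omega>)\<^sup>2)"
    using assms by (subst increment_distr) (auto simp: integral_distr)
  finally show ?thesis .
qed

lemma integral_increment:
  assumes "0 \<le> s" "s \<le> t"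
  shows "expectation (\<lambda>\<omega>. X t \<omega> - X s \<omega>) = expectation (X (t - s))"
proof -
  have "expectation (\<lambda>\<omega>. X t \<omega> - X s \<omega>) = (\<integral>x. x \<partial>distr M borel (\<lambda>\<omega>. X t \<omega> - X s \<omega>))"
    using assms by (subst integral_distr) auto
  also have "\<dots> = expectation (X (t - s))"
    using assms by (subst increment_distr) (auto simp: integral_distr)
  finally show ?thesis .
qed

text \<open>For t <= 1, X 1 is almost surely the sum of the independent increments over [0, t] and
  [t, 1], so \<open>indep_summand_sq_integrable\<close> applies. Larger times are reached in unit
  steps, as X t - X 1 has the law of X (t - 1).\<close>

lemma integrable_sq:
  assumes "0 \<le> t"
  shows "integrable M (\<lambda>\<omega>. (X t \<omega>)\<^sup>2)"
proof -
  have unit: "integrable M (\<lambda>\<omega>. (X t \<omega>)\<^sup>2)" if t: "0 \<le> t" "t \<le> 1" for t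
  proof -
    have "integrable M (\<lambda>\<omega>. (X t \<omega> - X 0 \<omega> + (X 1 \<omega> - X t \<omega>))\<^sup>2) \<longleftrightarrow> integrable M (\<lambda>\<omega>. (X 1 \<omega>)\<^sup>2)"
      using t AE_zero by (intro integrable_cong_AE) auto
    with sq_one have "integrable M (\<lambda>\<omega>. (X t \<omega> - X 0 \<omega> + (X 1 \<omega> - X t \<omega>))\<^sup>2)" by simp
    from indep_summand_sq_integrable[OF increment_indep this] t
    show ?thesis using integrable_sq_increment_iff[of 0 t] by simp
  qed
  have "integrable M (\<lambda>\<omega>. (X t \<omega>)\<^sup>2)" if "0 \<le> t" "t \<le> real (Suc n)" for n t
    using that
  proof (induction n arbitrary: t)
    case 0
    then show ?case by (intro unit) auto
  next
    case (Suc n)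
    show ?case
    proof (cases "t \<le> 1")
      case False
      have "integrable M (\<lambda>\<omega>. (X t \<omega> - X 1 \<omega>)\<^sup>2)"
        using False Suc by (subst integrable_sq_increment_iff) auto
      from integrable_sq_add[OF _ _ this sq_one] False show ?thesis by simp
    qed (use Suc unit in auto)
  qed
  from this[OF assms, of "nat \<lceil>t\<rceil>"] show ?thesis by linarith
qed

lemma integrable_X: "0 \<le> t \<Longrightarrow> integrable M (X t)"
  using square_integrable_imp_integrable[OF rv integrable_sq] .

lemma integrable_sq_increment:
  "0 \<le> s \<Longrightarrow> s \<le> t \<Longrightarrow> integrable M (\<lambda>\<omega>. (X t \<omega> - X s \<omega>)\<^sup>2)"
  by (simp add: integrable_sq_increment_iff integrable_sq)

lemma expectation_mult_increment:
  assumes "0 \<le> s" "s \<le> t"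
  shows "expectation (\<lambda>\<omega>. X s \<omega> * (X t \<omega> - X s \<omega>)) = expectation (X s) * expectation (X (t - s))"
proof -
  \<comment> \<open>Independence is available for increments only, and X 0 is zero only almost
    surely.\<close>
  have "expectation (\<lambda>\<omega>. X s \<omega> * (X t \<omega> - X s \<omega>)) = expectation (\<lambda>\<omega>. (X s \<omega> - X 0 \<omega>) * (X t \<omega> - X s \<omega>))"
    using assms AE_zero by (intro integral_cong_AE) auto
  also have "\<dots> = expectation (\<lambda>\<omega>. X s \<omega> - X 0 \<omega>) * expectation (\<lambda>\<omega>. X t \<omega> - X s \<omega>)"
    using assms by (intro indep_var_lebesgue_integral increment_indep) (auto intro!: Bochner_Integration.integrable_diff integrable_X)
  finally show ?thesis using assms by (simp only: integral_increment) simp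
qed

lemma mean_add:
  assumes "0 \<le> s" "0 \<le> t"
  shows "expectation (X (s + t)) = expectation (X s) + expectation (X t)"
  using integral_increment[of s "s + t"] Bochner_Integration.integral_diff[OF integrable_X integrable_X, of "s + t" s] assms
  by simp

text \<open>Means are carried along, because \<open>mean_zero\<close> itself rests on linearity of
  the variance. The cross term 2 E(X s) E(X t) cancels against the square of the added
  means.\<close>

lemma variance_add:
  assumes "0 \<le> s" "0 \<le> t"
  shows "variance (X (s + t)) = variance (X s) + variance (X t)"
proof -
  have V: "variance (X t) = expectation (\<lambda>\<omega>. (X t \<omega>)\<^sup>2) - (expectation (X t))\<^sup>2" if "0 \<le> t" for t
    using that by (intro variance_eq integrable_X integrable_sq)
  have "expectation (\<lambda>\<omega>. (X (s + t) \<omega>)\<^sup>2) =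
      expectation (\<lambda>\<omega>. (X s \<omega>)\<^sup>2 + 2 * (X s \<omega> * (X (s + t) \<omega> - X s \<omega>)) + (X (s + t) \<omega> - X s \<omega>)\<^sup>2)"
    by (intro Bochner_Integration.integral_cong refl) (simp add: power2_eq_square algebra_simps)
  also have "\<dots> = expectation (\<lambda>\<omega>. (X s \<omega>)\<^sup>2) + 2 * expectation (\<lambda>\<omega>. X s \<omega> * (X (s + t) \<omega> - X s \<omega>))
       + expectation (\<lambda>\<omega>. (X (s + t) \<omega> - X s \<omega>)\<^sup>2)"
  proof -
    have "integrable M (\<lambda>\<omega>. X s \<omega> * (X (s + t) \<omega> - X s \<omega>))"
      using assms by (intro integrable_mult_of_sq integrable_sq integrable_sq_increment) auto
    then show ?thesis using integrable_sq[of s] integrable_sq_increment[of s "s + t"] assms by simp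
  qed
  finally have "expectation (\<lambda>\<omega>. (X (s + t) \<omega>)\<^sup>2) = expectation (\<lambda>\<omega>. (X s \<omega>)\<^sup>2)
      + 2 * (expectation (X s) * expectation (X t)) + expectation (\<lambda>\<omega>. (X t \<omega>)\<^sup>2)"
    using assms expectation_mult_increment[of s "s + t"] integral_sq_increment[of s "s + t"] by simp
  then show ?thesis
    using assms V[of s] V[of t] V[of "s + t"] mean_add[OF assms] by (simp add: power2_sum)
qed

lemma variance_linear: "0 \<le> t \<Longrightarrow> variance (X t) = t * variance (X 1)"
  by (rule additive_nonneg_linear[of "\<lambda>t. variance (X t)"]) (auto intro: variance_add variance_positive)

text \<open>The mean is additive in time, so it vanishes once it is bounded near 0. Chebyshev's
  inequality together with stochastic continuity at 0 bounds it.\<close>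

lemma mean_zero:
  assumes "0 \<le> t"
  shows "expectation (X t) = 0"
proof -
  \<comment> \<open>Chosen so that Chebyshev's bound is at most 1/4 for all h < 1; the summand 1
    keeps a positive when the variance is 0.\<close>
  define a where "a = 2 * sqrt (variance (X 1)) + 1"
  have a: "0 < a" "4 * variance (X 1) \<le> a\<^sup>2"
    using variance_positive[of "X 1"] by (auto simp: a_def power2_sum power_mult_distrib add_nonneg_pos)
  have "((\<lambda>h. prob {\<omega> \<in> space M. \<bar>X h \<omega> - X 0 \<omega>\<bar> > 1}) \<longlongrightarrow> 0) (at 0 within {0..})"
  proof -
    have "\<forall>t\<ge>0. \<forall>e>0. ((\<lambda>h. prob {\<omega> \<in> space M. \<bar>X h \<omega> - X t \<omega>\<bar> > e}) \<longlongrightarrow> 0) (at t within {0..})"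
      using levy unfolding levy_process_def by blast
    then show ?thesis by simp
  qed
  then have "eventually (\<lambda>h. prob {\<omega> \<in> space M. \<bar>X h \<omega> - X 0 \<omega>\<bar> > 1} < 1/2) (at 0 within {0..})"
    by (rule order_tendstoD) simp
  then obtain d where d: "0 < d" "\<And>h. 0 < h \<Longrightarrow> h < d \<Longrightarrow> prob {\<omega> \<in> space M. \<bar>X h \<omega> - X 0 \<omega>\<bar> > 1} < 1/2"
    unfolding eventually_at by (auto simp: dist_real_def)
  have "\<bar>expectation (X h)\<bar> \<le> a + 1" if h: "0 < h" "h < min d 1" for h
  proof (rule ccontr)
    assume neg: "\<not> \<bar>expectation (X h)\<bar> \<le> a + 1"
    \<comment> \<open>If the mean exceeds a + 1 in absolute value, X h cannot be both within 1 of X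
      0 = 0 and within a of its mean. The two events would then cover the space, although their
      probabilities sum to less than 1/2 + 1/4.\<close>
    have "AE \<omega> in M. \<omega> \<in> {\<omega> \<in> space M. \<bar>X h \<omega> - X 0 \<omega>\<bar> > 1} \<union> {\<omega> \<in> space M. a \<le> \<bar>X h \<omega> - expectation (X h)\<bar>}"
      using AE_zero AE_space by eventually_elim (use neg in auto)
    then have "1 \<le> prob ({\<omega> \<in> space M. \<bar>X h \<omega> - X 0 \<omega>\<bar> > 1} \<union> {\<omega> \<in> space M. a \<le> \<bar>X h \<omega> - expectation (X h)\<bar>})"
      using h by (subst (asm) prob_eq_1[symmetric]) auto
    also have "\<dots> \<le> prob {\<omega> \<in> space M. \<bar>X h \<omega> - X 0 \<omega>\<bar> > 1} + prob {\<omega> \<in> space M. a \<le> \<bar>X h \<omega> - expectation (X h)\<bar>}"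
      using h by (intro measure_Un_le) auto
    also have "prob {\<omega> \<in> space M. a \<le> \<bar>X h \<omega> - expectation (X h)\<bar>} \<le> variance (X h) / a\<^sup>2"
      using h a by (intro Chebyshev_inequality integrable_sq rv) auto
    also have "\<dots> \<le> 1 / 4"
    proof -
      have "h * variance (X 1) \<le> 1 * variance (X 1)"
        using h variance_positive[of "X 1"] by (intro mult_right_mono) auto
      then show ?thesis using a h by (simp add: variance_linear[of h] field_simps)
    qed
    finally show False using d(2)[of h] h by simp
  qed
  then show ?thesis
    using assms d(1) mean_one
    by (intro additive_bounded_zero[where f = "\<lambda>t. expectation (X t)" and d = "min d 1" and B = "a + 1",
          OF mean_add mean_one]) auto
qed

definition sigma2 :: real where "sigma2 = expectation (\<lambda>\<omega>. (X 1 \<omega>)\<^sup>2)"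

lemma second_moment: "0 \<le> t \<Longrightarrow> expectation (\<lambda>\<omega>. (X t \<omega>)\<^sup>2) = t * sigma2"
  using variance_linear[of t] by (simp add: mean_zero sigma2_def)

text \<open>For nonnegative times the right-hand side is \<open>sigma2\<close> times the smaller
  time. In X s * X t with s <= t, replacing X t by X s plus an increment leaves only E (X
  s)^2.\<close>

lemma covariance:
  assumes "0 \<le> s" "0 \<le> t"
  shows "expectation (\<lambda>\<omega>. X s \<omega> * X t \<omega>) = sigma2 * (\<bar>s\<bar> + \<bar>t\<bar> - \<bar>t - s\<bar>) / 2"
proof -
  have main: "expectation (\<lambda>\<omega>. X s \<omega> * X t \<omega>) = s * sigma2" if "0 \<le> s" "s \<le> t" for s t
  proof -
    have "expectation (\<lambda>\<omega>. X s \<omega> * X t \<omega>) = expectation (\<lambda>\<omega>. (X s \<omega>)\<^sup>2 + X s \<omega> * (X t \<omega> - X s \<omega>))"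
      by (intro Bochner_Integration.integral_cong refl) (simp add: power2_eq_square algebra_simps)
    also have "\<dots> = expectation (\<lambda>\<omega>. (X s \<omega>)\<^sup>2) + expectation (\<lambda>\<omega>. X s \<omega> * (X t \<omega> - X s \<omega>))"
      using that by (intro Bochner_Integration.integral_add integrable_sq integrable_mult_of_sq integrable_sq_increment) auto
    finally show ?thesis
      using that by (simp add: expectation_mult_increment mean_zero second_moment)
  qed
  show ?thesis
    using main[of s t] main[of t s] assms by (cases "s \<le> t") (auto simp: mult.commute)
qed

text \<open>By Fatou, the mean square distance to the left limit is 0. Nothing is claimed about
  measurability of the left limit itself.\<close>

lemma left_limit:
  assumes t: "0 < t"
  shows "AE \<omega> in M. Lim (at_left t) (\<lambda>u. X u \<omega>) = X t \<omega>"
proof -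
  define \<tau> where "\<tau> n = t - t / real (Suc (Suc n))" for n
  have \<tau>: "0 \<le> \<tau> n" "\<tau> n < t" for n using t by (auto simp: \<tau>_def field_simps)
  have "(\<lambda>n. t / real (Suc (Suc n))) \<longlonglongrightarrow> 0"
    using LIMSEQ_Suc[OF LIMSEQ_Suc[OF lim_const_over_n[of t]]] by simp
  then have \<tau>_lim: "\<tau> \<longlonglongrightarrow> t"
    unfolding \<tau>_def[abs_def] using tendsto_diff[OF tendsto_const[of t]] by fastforce
  have \<tau>_left: "filterlim \<tau> (at_left t) sequentially"
    unfolding filterlim_at using \<tau>_lim \<tau>(2) by (auto intro!: always_eventually simp: less_imp_neq)
  have [measurable]: "X t \<in> borel_measurable M" "X (\<tau> n) \<in> borel_measurable M" for n
    using t \<tau>(1) by auto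
  have "(\<integral>\<^sup>+ \<omega>. liminf (\<lambda>n. ennreal ((X t \<omega> - X (\<tau> n) \<omega>)\<^sup>2)) \<partial>M)
     \<le> liminf (\<lambda>n. \<integral>\<^sup>+ \<omega>. ennreal ((X t \<omega> - X (\<tau> n) \<omega>)\<^sup>2) \<partial>M)"
    by (intro nn_integral_liminf) measurable
  also have "\<dots> = liminf (\<lambda>n. ennreal ((t - \<tau> n) * sigma2))"
  proof -
    have "(\<integral>\<^sup>+ \<omega>. ennreal ((X t \<omega> - X (\<tau> n) \<omega>)\<^sup>2) \<partial>M) = ennreal ((t - \<tau> n) * sigma2)" for n
      using \<tau>[of n] integral_sq_increment[of "\<tau> n" t] integrable_sq_increment[of "\<tau> n" t] second_moment[of "t - \<tau> n"]
      by (subst nn_integral_eq_integral) auto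
    then show ?thesis by simp
  qed
  also have "\<dots> = 0"
  proof -
    have "(\<lambda>n. ennreal ((t - \<tau> n) * sigma2)) \<longlonglongrightarrow> ennreal ((t - t) * sigma2)"
      by (intro tendsto_ennrealI tendsto_mult tendsto_diff tendsto_const \<tau>_lim)
    from lim_imp_Liminf[OF _ this] show ?thesis by simp
  qed
  finally have "AE \<omega> in M. liminf (\<lambda>n. ennreal ((X t \<omega> - X (\<tau> n) \<omega>)\<^sup>2)) = 0"
    by (subst (asm) le_zero_eq, subst (asm) nn_integral_0_iff_AE) auto
  moreover have "AE \<omega> in M. \<exists>l. ((\<lambda>u. X u \<omega>) \<longlongrightarrow> l) (at_left t)"
  proof -
    have "AE \<omega> in M. \<forall>t\<ge>0. continuous (at_right t) (\<lambda>u. X u \<omega>) \<and>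
        (t > 0 \<longrightarrow> (\<exists>l. ((\<lambda>u. X u \<omega>) \<longlongrightarrow> l) (at_left t)))"
      using levy unfolding levy_process_def by blast
    then show ?thesis by eventually_elim (use t in auto)
  qed
  ultimately show ?thesis
  proof eventually_elim
    case (elim \<omega>)
    then obtain l where l: "((\<lambda>u. X u \<omega>) \<longlongrightarrow> l) (at_left t)" by blast
    have "(\<lambda>n. X (\<tau> n) \<omega>) \<longlonglongrightarrow> l"
      using filterlim_compose[OF l \<tau>_left] .
    then have "(\<lambda>n. ennreal ((X t \<omega> - X (\<tau> n) \<omega>)\<^sup>2)) \<longlonglongrightarrow> ennreal ((X t \<omega> - l)\<^sup>2)"
      by (intro tendsto_ennrealI tendsto_power tendsto_diff tendsto_const)
    then have "liminf (\<lambda>n. ennreal ((X t \<omega> - X (\<tau> n) \<omega>)\<^sup>2)) = ennreal ((X t \<omega> - l)\<^sup>2)"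
      by (intro lim_imp_Liminf) auto
    with elim have "X t \<omega> = l" by simp
    then show ?case using l tendsto_Lim[of "at_left t"] by simp
  qed
qed

end

subsection \<open>Integrals of step functions\<close>

lemma step_int_simps [simp]:
  "step_int L [] \<omega> = 0"
  "step_int L ((c, a, b) # ps) \<omega> = c * (L b \<omega> - L a \<omega>) + step_int L ps \<omega>"
  "step_int L (ps @ qs) \<omega> = step_int L ps \<omega> + step_int L qs \<omega>"
  by (simp_all add: step_int_def)

lemma step_fun_simps [simp]:
  "step_fun [] v = 0"
  "step_fun ((c, a, b) # ps) v = c * indicator {a<..b} v + step_fun ps v"
  "step_fun (ps @ qs) v = step_fun ps v + step_fun qs v"
  by (simp_all add: step_fun_def)

lemma valid_steps_simps [simp]:
  "valid_steps []"
  "valid_steps ((c, a, b) # ps) \<longleftrightarrow> a \<le> b \<and> valid_steps ps"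
  "valid_steps (ps @ qs) \<longleftrightarrow> valid_steps ps \<and> valid_steps qs"
  by (simp_all add: valid_steps_def)

definition scale_steps :: "real \<Rightarrow> (real \<times> real \<times> real) list \<Rightarrow> (real \<times> real \<times> real) list" where
  "scale_steps k = map (\<lambda>(c, a, b). (k * c, a, b))"

lemma scale_steps [simp]:
  "step_int L (scale_steps k ps) \<omega> = k * step_int L ps \<omega>"
  "step_fun (scale_steps k ps) v = k * step_fun ps v"
  "valid_steps (scale_steps k ps) = valid_steps ps"
  by (induction ps) (auto simp: scale_steps_def algebra_simps)

lemma measurable_step_fun [measurable]: "step_fun ps \<in> borel_measurable borel"
proof (induction ps)
  case (Cons p ps)
  then show ?case by (cases p) (simp add: step_fun_simps(2)[abs_def])
qed (simp add: step_fun_def[abs_def])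

lemma measurable_step_int:
  assumes "\<And>t. L t \<in> borel_measurable M"
  shows "step_int L ps \<in> borel_measurable M"
proof (induction ps)
  case (Cons p ps)
  then show ?case using assms by (cases p) (simp add: step_int_simps(2)[abs_def])
qed (simp add: step_int_def[abs_def])

text \<open>Linear extension in one argument from intervals to step functions. Two applications, one
  per factor, give the isometry.\<close>

lemma step_int_pairing:
  fixes \<sigma> :: real
  assumes base: "\<And>a b. a \<le> b \<Longrightarrow> integrable M (\<lambda>\<omega>. (L b \<omega> - L a \<omega>) * Z \<omega>)
      \<and> integrable lborel (\<lambda>v. indicator {a<..b} v * f v)
      \<and> (\<integral>\<omega>. (L b \<omega> - L a \<omega>) * Z \<omega> \<partial>M) = \<sigma> * (\<integral>v. indicator {a<..b} v * f v \<partial>lborel)"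
    and "valid_steps ps"
  shows "integrable M (\<lambda>\<omega>. step_int L ps \<omega> * Z \<omega>)
      \<and> integrable lborel (\<lambda>v. step_fun ps v * f v)
      \<and> (\<integral>\<omega>. step_int L ps \<omega> * Z \<omega> \<partial>M) = \<sigma> * (\<integral>v. step_fun ps v * f v \<partial>lborel)"
  using assms(2)
proof (induction ps)
  case (Cons p ps)
  obtain c a b where p: "p = (c, a, b)" by (cases p)
  then have ab: "a \<le> b" and "valid_steps ps" using Cons.prems by auto
  note IH = Cons.IH[OF this(2)] and B = base[OF ab]
  have 1: "(\<lambda>\<omega>. step_int L (p # ps) \<omega> * Z \<omega>) = (\<lambda>\<omega>. c * ((L b \<omega> - L a \<omega>) * Z \<omega>) + step_int L ps \<omega> * Z \<omega>)"
    by (auto simp: p algebra_simps)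
  have 2: "(\<lambda>v. step_fun (p # ps) v * f v) = (\<lambda>v. c * (indicator {a<..b} v * f v) + step_fun ps v * f v)"
    by (auto simp: p algebra_simps)
  show ?case
    unfolding 1 2 using IH B by (simp add: distrib_left mult.left_commute[of c \<sigma>])
qed simp

text \<open>The length of the overlap is written as a mixed second difference of the absolute value,
  the shape in which \<open>cov\<close> produces it.\<close>

lemma integral_indicator_overlap:
  fixes a b c d :: real
  assumes "a \<le> b" "c \<le> d"
  shows "integrable lborel (\<lambda>v. indicator {a<..b} v * indicator {c<..d} v :: real)"
    "(\<integral>v. indicator {a<..b} v * indicator {c<..d} v \<partial>lborel) = (\<bar>b - c\<bar> + \<bar>a - d\<bar> - \<bar>b - d\<bar> - \<bar>a - c\<bar>) / 2"
proof -
  have eq: "(\<lambda>v. indicator {a<..b} v * indicator {c<..d} v :: real) = indicator {max a c<..min b d}"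
    by (auto simp: fun_eq_iff split: split_indicator)
  show "integrable lborel (\<lambda>v. indicator {a<..b} v * indicator {c<..d} v :: real)"
    unfolding eq by (cases "max a c \<le> min b d") auto
  show "(\<integral>v. indicator {a<..b} v * indicator {c<..d} v \<partial>lborel) = (\<bar>b - c\<bar> + \<bar>a - d\<bar> - \<bar>b - d\<bar> - \<bar>a - c\<bar>) / 2"
    unfolding eq using assms by (cases "max a c \<le> min b d") auto
qed

text \<open>The covariance is that of two-sided Brownian motion, written without a case distinction on
  the signs of the time points.\<close>

locale orthogonal_increments = prob_space M for M :: "'a measure" +
  fixes L :: "real \<Rightarrow> 'a \<Rightarrow> real" and \<sigma> :: real
  assumes meas [measurable]: "\<And>t. L t \<in> borel_measurable M"
    and sq: "\<And>t. integrable M (\<lambda>\<omega>. (L t \<omega>)\<^sup>2)"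
    and cov: "\<And>s t. expectation (\<lambda>\<omega>. L s \<omega> * L t \<omega>) = \<sigma> * (\<bar>s\<bar> + \<bar>t\<bar> - \<bar>t - s\<bar>) / 2"
    and \<sigma>_nonneg: "0 \<le> \<sigma>"
begin

text \<open>Expanding into four covariances, the terms with one time point cancel and the mixed
  second difference of |t - s| remains.\<close>

lemma increment_pairing:
  assumes "a \<le> b" "c \<le> d"
  shows "integrable M (\<lambda>\<omega>. (L b \<omega> - L a \<omega>) * (L d \<omega> - L c \<omega>))"
    "expectation (\<lambda>\<omega>. (L b \<omega> - L a \<omega>) * (L d \<omega> - L c \<omega>))
      = \<sigma> * (\<integral>v. indicator {a<..b} v * indicator {c<..d} v \<partial>lborel)"
proof -
  have [simp]: "integrable M (\<lambda>\<omega>. L s \<omega> * L t \<omega>)" for s t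
    by (intro integrable_mult_of_sq sq meas)
  have eq: "(\<lambda>\<omega>. (L b \<omega> - L a \<omega>) * (L d \<omega> - L c \<omega>)) =
      (\<lambda>\<omega>. (L b \<omega> * L d \<omega> - L b \<omega> * L c \<omega>) - (L a \<omega> * L d \<omega> - L a \<omega> * L c \<omega>))"
    by (auto simp: algebra_simps)
  show "integrable M (\<lambda>\<omega>. (L b \<omega> - L a \<omega>) * (L d \<omega> - L c \<omega>))"
    unfolding eq by (intro Bochner_Integration.integrable_diff) auto
  have "expectation (\<lambda>\<omega>. (L b \<omega> - L a \<omega>) * (L d \<omega> - L c \<omega>)) =
      (expectation (\<lambda>\<omega>. L b \<omega> * L d \<omega>) - expectation (\<lambda>\<omega>. L b \<omega> * L c \<omega>)) -
      (expectation (\<lambda>\<omega>. L a \<omega> * L d \<omega>) - expectation (\<lambda>\<omega>. L a \<omega> * L c \<omega>))"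
    unfolding eq by simp
  then show "expectation (\<lambda>\<omega>. (L b \<omega> - L a \<omega>) * (L d \<omega> - L c \<omega>))
      = \<sigma> * (\<integral>v. indicator {a<..b} v * indicator {c<..d} v \<partial>lborel)"
    unfolding integral_indicator_overlap(2)[OF assms] cov
    by (simp add: field_simps abs_minus_commute)
qed

text \<open>The intervals of a step list may overlap. Bilinearity handles this without refining them
  to a disjoint partition.\<close>

lemma step_isometry:
  assumes "valid_steps ps"
  shows "(\<integral>\<^sup>+\<omega>. ennreal ((step_int L ps \<omega>)\<^sup>2) \<partial>M) = ennreal \<sigma> * (\<integral>\<^sup>+v. ennreal ((step_fun ps v)\<^sup>2) \<partial>lborel)"
proof -
  have 1: "integrable M (\<lambda>\<omega>. step_int L ps \<omega> * (L d \<omega> - L c \<omega>))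
      \<and> integrable lborel (\<lambda>v. step_fun ps v * indicator {c<..d} v)
      \<and> (\<integral>\<omega>. step_int L ps \<omega> * (L d \<omega> - L c \<omega>) \<partial>M) = \<sigma> * (\<integral>v. step_fun ps v * indicator {c<..d} v \<partial>lborel)"
    if "c \<le> d" for c d
    using assms that by (intro step_int_pairing conjI increment_pairing integral_indicator_overlap)
  have "integrable M (\<lambda>\<omega>. step_int L ps \<omega> * step_int L ps \<omega>)
      \<and> integrable lborel (\<lambda>v. step_fun ps v * step_fun ps v)
      \<and> (\<integral>\<omega>. step_int L ps \<omega> * step_int L ps \<omega> \<partial>M) = \<sigma> * (\<integral>v. step_fun ps v * step_fun ps v \<partial>lborel)"
    by (rule step_int_pairing) (use assms 1 in \<open>auto simp: mult.commute\<close>)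
  then show ?thesis
    using \<sigma>_nonneg by (simp add: power2_eq_square nn_integral_eq_integral ennreal_mult')
qed

text \<open>Each integral comes with its own approximating step lists, on which
  \<open>step_isometry\<close> holds for the combination. The inequality (p + q + r + w)^2 <= 4 (p^2
  + q^2 + r^2 + w^2), used once in the probability space and once on the line, gives 16 = 4 *
  4.\<close>

lemma L_integral_combination_bound:
  fixes f1 f2 f3 :: "real \<Rightarrow> real" and k :: real
  assumes X1: "is_L_integral M L f1 X1" and X2: "is_L_integral M L f2 X2" and X3: "is_L_integral M L f3 X3"
    and [measurable]: "f1 \<in> borel_measurable borel" "f2 \<in> borel_measurable borel" "f3 \<in> borel_measurable borel"
  shows "(\<integral>\<^sup>+\<omega>. ennreal ((X1 \<omega> - X2 \<omega> - k * X3 \<omega>)\<^sup>2) \<partial>M)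
    \<le> ennreal (16 * \<sigma>) * (\<integral>\<^sup>+v. ennreal ((f1 v - f2 v - k * f3 v)\<^sup>2) \<partial>lborel)"
proof -
  have sq4: "(x1 - x2 - k * x3)\<^sup>2 \<le> 4 * ((x1 - y1)\<^sup>2 + (x2 - y2)\<^sup>2 + k\<^sup>2 * (x3 - y3)\<^sup>2 + (y1 - y2 - k * y3)\<^sup>2)"
    for x1 x2 x3 y1 y2 y3 :: real
  proof -
    have four: "(p + q + r + w)\<^sup>2 \<le> 4 * (p\<^sup>2 + q\<^sup>2 + r\<^sup>2 + w\<^sup>2)" for p q r w :: real
    proof -
      have "0 \<le> (p - q)\<^sup>2 + (p - r)\<^sup>2 + (p - w)\<^sup>2 + (q - r)\<^sup>2 + (q - w)\<^sup>2 + (r - w)\<^sup>2" by simp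
      then show ?thesis by (simp add: power2_eq_square algebra_simps)
    qed
    have "x1 - x2 - k * x3 = (x1 - y1) + (y2 - x2) + k * (y3 - x3) + (y1 - y2 - k * y3)"
      by (simp add: algebra_simps)
    also have "\<dots>\<^sup>2 \<le> 4 * ((x1 - y1)\<^sup>2 + (y2 - x2)\<^sup>2 + (k * (y3 - x3))\<^sup>2 + (y1 - y2 - k * y3)\<^sup>2)"
      by (rule four)
    finally show ?thesis
      by (simp add: power_mult_distrib power2_commute)
  qed
  have nn4: "(\<integral>\<^sup>+x. ennreal ((x1 x - x2 x - k * x3 x)\<^sup>2) \<partial>N)
     \<le> 4 * ((\<integral>\<^sup>+x. ennreal ((x1 x - y1 x)\<^sup>2) \<partial>N) + (\<integral>\<^sup>+x. ennreal ((x2 x - y2 x)\<^sup>2) \<partial>N)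
        + ennreal (k\<^sup>2) * (\<integral>\<^sup>+x. ennreal ((x3 x - y3 x)\<^sup>2) \<partial>N)
        + (\<integral>\<^sup>+x. ennreal ((y1 x - y2 x - k * y3 x)\<^sup>2) \<partial>N))"
    if [measurable]: "x1 \<in> borel_measurable N" "x2 \<in> borel_measurable N" "x3 \<in> borel_measurable N"
       "y1 \<in> borel_measurable N" "y2 \<in> borel_measurable N" "y3 \<in> borel_measurable N"
    for N :: "'c measure" and x1 x2 x3 y1 y2 y3 :: "'c \<Rightarrow> real"
  proof -
    have "(\<integral>\<^sup>+x. ennreal ((x1 x - x2 x - k * x3 x)\<^sup>2) \<partial>N) \<le>
       (\<integral>\<^sup>+x. 4 * (ennreal ((x1 x - y1 x)\<^sup>2) + ennreal ((x2 x - y2 x)\<^sup>2)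
        + ennreal (k\<^sup>2) * ennreal ((x3 x - y3 x)\<^sup>2) + ennreal ((y1 x - y2 x - k * y3 x)\<^sup>2)) \<partial>N)"
    proof (intro nn_integral_mono)
      fix x
      have "ennreal ((x1 x - x2 x - k * x3 x)\<^sup>2) \<le> ennreal (4 * ((x1 x - y1 x)\<^sup>2 + (x2 x - y2 x)\<^sup>2
          + k\<^sup>2 * (x3 x - y3 x)\<^sup>2 + (y1 x - y2 x - k * y3 x)\<^sup>2))"
        by (intro ennreal_leI sq4)
      then show "ennreal ((x1 x - x2 x - k * x3 x)\<^sup>2) \<le> 4 * (ennreal ((x1 x - y1 x)\<^sup>2) + ennreal ((x2 x - y2 x)\<^sup>2)
        + ennreal (k\<^sup>2) * ennreal ((x3 x - y3 x)\<^sup>2) + ennreal ((y1 x - y2 x - k * y3 x)\<^sup>2))"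
        by (simp add: ennreal_mult' ennreal_plus)
    qed
    also have "\<dots> = 4 * ((\<integral>\<^sup>+x. ennreal ((x1 x - y1 x)\<^sup>2) \<partial>N) + (\<integral>\<^sup>+x. ennreal ((x2 x - y2 x)\<^sup>2) \<partial>N)
        + ennreal (k\<^sup>2) * (\<integral>\<^sup>+x. ennreal ((x3 x - y3 x)\<^sup>2) \<partial>N)
        + (\<integral>\<^sup>+x. ennreal ((y1 x - y2 x - k * y3 x)\<^sup>2) \<partial>N))"
      by (simp add: nn_integral_cmult nn_integral_add)
    finally show ?thesis .
  qed
  from X1 X2 X3 have [measurable]: "X1 \<in> borel_measurable M" "X2 \<in> borel_measurable M" "X3 \<in> borel_measurable M"
    by (auto simp: is_L_integral_def)
  have [measurable]: "step_int L ps \<in> borel_measurable M" for ps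
    by (intro measurable_step_int meas)
  obtain p1 where p1: "\<And>n. valid_steps (p1 n)"
      "(\<lambda>n. \<integral>\<^sup>+v. ennreal ((f1 v - step_fun (p1 n) v)\<^sup>2) \<partial>lborel) \<longlonglongrightarrow> 0"
      "(\<lambda>n. \<integral>\<^sup>+\<omega>. ennreal ((X1 \<omega> - step_int L (p1 n) \<omega>)\<^sup>2) \<partial>M) \<longlonglongrightarrow> 0"
    using X1 unfolding is_L_integral_def by blast
  obtain p2 where p2: "\<And>n. valid_steps (p2 n)"
      "(\<lambda>n. \<integral>\<^sup>+v. ennreal ((f2 v - step_fun (p2 n) v)\<^sup>2) \<partial>lborel) \<longlonglongrightarrow> 0"
      "(\<lambda>n. \<integral>\<^sup>+\<omega>. ennreal ((X2 \<omega> - step_int L (p2 n) \<omega>)\<^sup>2) \<partial>M) \<longlonglongrightarrow> 0"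
    using X2 unfolding is_L_integral_def by blast
  obtain p3 where p3: "\<And>n. valid_steps (p3 n)"
      "(\<lambda>n. \<integral>\<^sup>+v. ennreal ((f3 v - step_fun (p3 n) v)\<^sup>2) \<partial>lborel) \<longlonglongrightarrow> 0"
      "(\<lambda>n. \<integral>\<^sup>+\<omega>. ennreal ((X3 \<omega> - step_int L (p3 n) \<omega>)\<^sup>2) \<partial>M) \<longlonglongrightarrow> 0"
    using X3 unfolding is_L_integral_def by blast
  define I where "I = (\<integral>\<^sup>+v. ennreal ((f1 v - f2 v - k * f3 v)\<^sup>2) \<partial>lborel)"
  \<comment> \<open>A n collects the errors of the random variables, B n those of the integrands.
    Both tend to 0, so only I survives in the limit.\<close>
  define A where "A n = (\<integral>\<^sup>+\<omega>. ennreal ((X1 \<omega> - step_int L (p1 n) \<omega>)\<^sup>2) \<partial>M)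
      + (\<integral>\<^sup>+\<omega>. ennreal ((X2 \<omega> - step_int L (p2 n) \<omega>)\<^sup>2) \<partial>M)
      + ennreal (k\<^sup>2) * (\<integral>\<^sup>+\<omega>. ennreal ((X3 \<omega> - step_int L (p3 n) \<omega>)\<^sup>2) \<partial>M)" for n
  define B where "B n = (\<integral>\<^sup>+v. ennreal ((f1 v - step_fun (p1 n) v)\<^sup>2) \<partial>lborel)
      + (\<integral>\<^sup>+v. ennreal ((f2 v - step_fun (p2 n) v)\<^sup>2) \<partial>lborel)
      + ennreal (k\<^sup>2) * (\<integral>\<^sup>+v. ennreal ((f3 v - step_fun (p3 n) v)\<^sup>2) \<partial>lborel)" for n
  have "A \<longlonglongrightarrow> 0 + 0 + ennreal (k\<^sup>2) * 0"
    unfolding A_def[abs_def] by (intro tendsto_add ennreal_tendsto_cmult p1 p2 p3) auto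
  moreover have "B \<longlonglongrightarrow> 0 + 0 + ennreal (k\<^sup>2) * 0"
    unfolding B_def[abs_def] by (intro tendsto_add ennreal_tendsto_cmult p1 p2 p3) auto
  ultimately have "(\<lambda>n. 4 * (A n + ennreal \<sigma> * (4 * (B n + I)))) \<longlonglongrightarrow> 4 * ((0 + 0 + ennreal (k\<^sup>2) * 0) + ennreal \<sigma> * (4 * ((0 + 0 + ennreal (k\<^sup>2) * 0) + I)))"
    by (intro tendsto_add ennreal_tendsto_cmult tendsto_const) auto
  moreover have "(\<integral>\<^sup>+\<omega>. ennreal ((X1 \<omega> - X2 \<omega> - k * X3 \<omega>)\<^sup>2) \<partial>M) \<le> 4 * (A n + ennreal \<sigma> * (4 * (B n + I)))" for n
  proof -
    define q where "q = p1 n @ scale_steps (-1) (p2 n) @ scale_steps (-k) (p3 n)"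
    have "(\<integral>\<^sup>+v. ennreal ((step_fun (p1 n) v - step_fun (p2 n) v - k * step_fun (p3 n) v)\<^sup>2) \<partial>lborel) \<le> 4 * (B n + I)"
      using nn4[of "step_fun (p1 n)" lborel "step_fun (p2 n)" "step_fun (p3 n)" f1 f2 f3]
      unfolding B_def I_def power2_commute[of "step_fun _ _"] by simp
    moreover have "(\<integral>\<^sup>+\<omega>. ennreal ((step_int L (p1 n) \<omega> - step_int L (p2 n) \<omega> - k * step_int L (p3 n) \<omega>)\<^sup>2) \<partial>M)
      = ennreal \<sigma> * (\<integral>\<^sup>+v. ennreal ((step_fun (p1 n) v - step_fun (p2 n) v - k * step_fun (p3 n) v)\<^sup>2) \<partial>lborel)"
      using step_isometry[of q] p1(1) p2(1) p3(1) by (simp add: q_def algebra_simps)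
    ultimately have S: "(\<integral>\<^sup>+\<omega>. ennreal ((step_int L (p1 n) \<omega> - step_int L (p2 n) \<omega> - k * step_int L (p3 n) \<omega>)\<^sup>2) \<partial>M)
      \<le> ennreal \<sigma> * (4 * (B n + I))"
      by (simp add: mult_left_mono)
    have "(\<integral>\<^sup>+\<omega>. ennreal ((X1 \<omega> - X2 \<omega> - k * X3 \<omega>)\<^sup>2) \<partial>M) \<le> 4 * (A n +
        (\<integral>\<^sup>+\<omega>. ennreal ((step_int L (p1 n) \<omega> - step_int L (p2 n) \<omega> - k * step_int L (p3 n) \<omega>)\<^sup>2) \<partial>M))"
      unfolding A_def by (intro nn4) auto
    also have "\<dots> \<le> 4 * (A n + ennreal \<sigma> * (4 * (B n + I)))"
      by (intro mult_left_mono add_left_mono S) simp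
    finally show ?thesis .
  qed
  ultimately have "(\<integral>\<^sup>+\<omega>. ennreal ((X1 \<omega> - X2 \<omega> - k * X3 \<omega>)\<^sup>2) \<partial>M)
      \<le> 4 * ((0 + 0 + ennreal (k\<^sup>2) * 0) + ennreal \<sigma> * (4 * ((0 + 0 + ennreal (k\<^sup>2) * 0) + I)))"
    by (intro LIMSEQ_le_const) auto
  also have "\<dots> = ennreal (16 * \<sigma>) * I"
  proof -
    have "ennreal (16 * \<sigma>) = 4 * (ennreal \<sigma> * 4)"
      using ennreal_mult'[of 4 "\<sigma> * 4"] ennreal_mult''[of 4 \<sigma>] by simp
    then show ?thesis by (simp add: mult.assoc)
  qed
  finally show ?thesis unfolding I_def .
qed

end

subsection \<open>The two-sided process\<close>

text \<open>With values instead of left limits on the negative axis: unlike \<open>two_sided\<close>, which agrees with it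
  almost surely at each time, this is measurable without completeness of the measure.\<close>

definition two_sided_mod :: "(real \<Rightarrow> 'a \<Rightarrow> real) \<Rightarrow> (real \<Rightarrow> 'a \<Rightarrow> real) \<Rightarrow> real \<Rightarrow> 'a \<Rightarrow> real" where
  "two_sided_mod L1 L2 t \<omega> = (if t \<ge> 0 then L1 t \<omega> else - L2 (-t) \<omega>)"

text \<open>A step integral involves finitely many times, so almost sure equality at each fixed time
  suffices; no common null set for all times is required.\<close>

lemma is_L_integral_cong_AE:
  assumes ae: "\<And>t. AE \<omega> in M. L t \<omega> = L' t \<omega>" and "is_L_integral M L f X"
  shows "is_L_integral M L' f X"
proof -
  have int: "AE \<omega> in M. step_int L ps \<omega> = step_int L' ps \<omega>" for ps
  proof (induction ps)
    case (Cons p ps)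
    obtain c a b where p: "p = (c, a, b)" by (cases p)
    show ?case
      using Cons ae[of a] ae[of b] by eventually_elim (simp add: p)
  qed simp
  have "AE \<omega> in M. ennreal ((X \<omega> - step_int L ps \<omega>)\<^sup>2) = ennreal ((X \<omega> - step_int L' ps \<omega>)\<^sup>2)" for ps
    using int[of ps] by eventually_elim simp
  then have "(\<integral>\<^sup>+ \<omega>. ennreal ((X \<omega> - step_int L ps \<omega>)\<^sup>2) \<partial>M) = (\<integral>\<^sup>+ \<omega>. ennreal ((X \<omega> - step_int L' ps \<omega>)\<^sup>2) \<partial>M)" for ps
    by (rule nn_integral_cong_AE)
  with assms(2) show ?thesis by (simp add: is_L_integral_def)
qed

text \<open>For times of opposite sign, |t - s| = |s| + |t|, and independence with zero means makes
  the covariance 0 as well. For two negative times the minus signs cancel.\<close>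

lemma two_sided_mod_orthogonal_increments:
  assumes 1: "centered_levy M L1" and 2: "centered_levy M L2"
    and \<sigma>: "integral\<^sup>L M (\<lambda>\<omega>. (L1 1 \<omega>)\<^sup>2) = \<sigma>" "integral\<^sup>L M (\<lambda>\<omega>. (L2 1 \<omega>)\<^sup>2) = \<sigma>"
    and ind: "\<And>s t. 0 \<le> s \<Longrightarrow> 0 \<le> t \<Longrightarrow> prob_space.indep_var M borel (L1 s) borel (L2 t)"
  shows "orthogonal_increments M (two_sided_mod L1 L2) \<sigma>"
proof -
  interpret L1: centered_levy M L1 by fact
  interpret L2: centered_levy M L2 by fact
  have [simp]: "L1.sigma2 = \<sigma>" "L2.sigma2 = \<sigma>"
    using \<sigma> by (simp_all add: L1.sigma2_def L2.sigma2_def)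
  have zero: "integral\<^sup>L M (\<lambda>\<omega>. L1 s \<omega> * L2 t \<omega>) = 0" if "0 \<le> s" "0 \<le> t" for s t
    using L1.indep_var_lebesgue_integral[OF ind[OF that] L1.integrable_X[OF that(1)] L2.integrable_X[OF that(2)]] that
    by (simp add: L1.mean_zero)
  show ?thesis
  proof
    show "two_sided_mod L1 L2 t \<in> borel_measurable M" for t
      unfolding two_sided_mod_def[abs_def] by (cases "0 \<le> t") (auto intro!: borel_measurable_uminus)
    show "integrable M (\<lambda>\<omega>. (two_sided_mod L1 L2 t \<omega>)\<^sup>2)" for t
      by (cases "0 \<le> t") (auto simp: two_sided_mod_def L1.integrable_sq L2.integrable_sq)
    show "integral\<^sup>L M (\<lambda>\<omega>. two_sided_mod L1 L2 s \<omega> * two_sided_mod L1 L2 t \<omega>) = \<sigma> * (\<bar>s\<bar> + \<bar>t\<bar> - \<bar>t - s\<bar>) / 2" for s t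
      using L1.covariance[of s t] L2.covariance[of "-s" "-t"] zero[of s "-t"] zero[of t "-s"]
      by (cases "0 \<le> s"; cases "0 \<le> t")
        (auto simp: two_sided_mod_def mult.commute abs_minus_commute)
    show "0 \<le> \<sigma>"
      unfolding \<sigma>(1)[symmetric] by (rule Bochner_Integration.integral_nonneg) simp
  qed
qed

section \<open>Measurability of the integrands and the final estimate\<close>

lemma measurable_z_H [measurable]: "(\<lambda>u. z_H H r u) \<in> borel_measurable borel"
  unfolding z_H_def[abs_def] hyp2F1_def[abs_def] hyp_series_def[abs_def] by measurable

lemma measurable_pos_pow [measurable]: "(\<lambda>x. pos_pow x a) \<in> borel_measurable borel"
  unfolding pos_pow_def[abs_def] by measurable

theorem mainTheorem10:
  fixes M :: "'a measure" and L1 L2 :: "real \<Rightarrow> 'a \<Rightarrow> real" and H :: real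
  assumes "0 < H" and "H < 1"
    and "levy_process M L1" and "levy_process M L2"
    and "prob_space.indep_var M
           (Pi\<^sub>M {0..} (\<lambda>_. borel)) (\<lambda>\<omega>. \<lambda>t\<in>{0::real..}. L1 t \<omega>)
           (Pi\<^sub>M {0..} (\<lambda>_. borel)) (\<lambda>\<omega>. \<lambda>t\<in>{0::real..}. L2 t \<omega>)"
    and "distr M (Pi\<^sub>M {0..} (\<lambda>_. borel)) (\<lambda>\<omega>. \<lambda>t\<in>{0::real..}. L1 t \<omega>) =
         distr M (Pi\<^sub>M {0..} (\<lambda>_. borel)) (\<lambda>\<omega>. \<lambda>t\<in>{0::real..}. L2 t \<omega>)"
    and "no_gaussian_part M L1"
    and "integrable M (L1 1)" and "integral\<^sup>L M (L1 1) = 0"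
    and "integrable M (\<lambda>\<omega>. (L1 1 \<omega>)\<^sup>2)"
  shows "\<forall>t::real. \<exists>S>0. \<exists>C>0. \<forall>s>S. \<forall>X1 X2 X3.
           -s \<le> t \<longrightarrow>
           is_L_integral M (two_sided L1 L2)
             (\<lambda>v. indicator {-s..t} v * z_H H (t + s) (v + s)) X1 \<longrightarrow>
           is_L_integral M (two_sided L1 L2)
             (\<lambda>v. indicator {-s..0} v * z_H H s (v + s)) X2 \<longrightarrow>
           is_L_integral M (two_sided L1 L2)
             (\<lambda>v. pos_pow (t - v) (H - 1/2) - pos_pow (- v) (H - 1/2)) X3 \<longrightarrow>
           (\<integral>\<^sup>+ \<omega>. ennreal ((X1 \<omega> - X2 \<omega> - c_H H * X3 \<omega>)\<^sup>2) \<partial>M)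
             \<le> ennreal (C * s powr (2 * H - 2))"
proof (rule allI, goal_cases)
  case (1 t)
  interpret prob_space M using assms(3) by (simp add: levy_process_def)
  interpret L1: centered_levy M L1
    by unfold_locales (use assms in auto)
  have rv2: "L2 t \<in> borel_measurable M" if "0 \<le> t" for t
    using assms(4) that by (simp add: levy_process_def)
  \<comment> \<open>The equality of the path laws enters through its marginal at time 1, which
    carries the moment assumptions from L1 over to L2.\<close>
  have "distr M borel (L1 1) = distr M borel (L2 1)"
  proof -
    let ?P = "Pi\<^sub>M {0::real..} (\<lambda>_. borel :: real measure)"
    have p: "(\<lambda>f. f 1) \<in> ?P \<rightarrow>\<^sub>M borel" by (rule measurable_component_singleton) simp
    have m: "(\<lambda>\<omega>. \<lambda>t\<in>{0::real..}. L1 t \<omega>) \<in> M \<rightarrow>\<^sub>M ?P" "(\<lambda>\<omega>. \<lambda>t\<in>{0::real..}. L2 t \<omega>) \<in> M \<rightarrow>\<^sub>M ?P"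
      using indep_var_rv1[OF assms(5)] indep_var_rv2[OF assms(5)] .
    show ?thesis
      using arg_cong[OF assms(6), of "\<lambda>N. distr N borel (\<lambda>f. f 1)"]
      by (simp add: distr_distr[OF p m(1)] distr_distr[OF p m(2)] comp_def)
  qed
  note law = this
  have L2_one: "integrable M (\<lambda>\<omega>. (L2 1 \<omega>)\<^sup>2)" "expectation (L2 1) = 0"
    "expectation (\<lambda>\<omega>. (L2 1 \<omega>)\<^sup>2) = expectation (\<lambda>\<omega>. (L1 1 \<omega>)\<^sup>2)"
  proof -
    have "integrable (distr M borel (L1 1)) (\<lambda>x. x\<^sup>2)"
      using assms(10) by (subst integrable_distr_eq) auto
    then show "integrable M (\<lambda>\<omega>. (L2 1 \<omega>)\<^sup>2)"
      unfolding law by (subst (asm) integrable_distr_eq) (auto simp: rv2)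
    have "(\<integral>x. x \<partial>distr M borel (L1 1)) = 0"
      using assms(9) by (subst integral_distr) auto
    then show "expectation (L2 1) = 0"
      unfolding law by (subst (asm) integral_distr) (auto simp: rv2)
    have "(\<integral>x. x\<^sup>2 \<partial>distr M borel (L1 1)) = expectation (\<lambda>\<omega>. (L1 1 \<omega>)\<^sup>2)"
      by (subst integral_distr) auto
    then show "expectation (\<lambda>\<omega>. (L2 1 \<omega>)\<^sup>2) = expectation (\<lambda>\<omega>. (L1 1 \<omega>)\<^sup>2)"
      unfolding law by (subst (asm) integral_distr) (auto simp: rv2)
  qed
  interpret L2: centered_levy M L2
    by unfold_locales (use assms(4) L2_one in auto)
  have ind: "indep_var borel (L1 s) borel (L2 t)" if "0 \<le> s" "0 \<le> t" for s t
  proof -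
    have "indep_var borel ((\<lambda>f. f s) \<circ> (\<lambda>\<omega>. \<lambda>t\<in>{0::real..}. L1 t \<omega>)) borel ((\<lambda>f. f t) \<circ> (\<lambda>\<omega>. \<lambda>t\<in>{0::real..}. L2 t \<omega>))"
      using that by (intro indep_var_compose[OF assms(5)] measurable_component_singleton) auto
    then show ?thesis using that by (simp add: comp_def)
  qed
  define \<sigma> where "\<sigma> = expectation (\<lambda>\<omega>. (L1 1 \<omega>)\<^sup>2)"
  interpret L: orthogonal_increments M "two_sided_mod L1 L2" \<sigma>
    by (rule two_sided_mod_orthogonal_increments[OF L1.centered_levy_axioms L2.centered_levy_axioms])
      (auto simp: \<sigma>_def L2_one ind)
  have ae: "AE \<omega> in M. two_sided L1 L2 t \<omega> = two_sided_mod L1 L2 t \<omega>" for t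
  proof (cases "0 \<le> t")
    case False
    then have "AE \<omega> in M. Lim (at_left (-t)) (\<lambda>u. L2 u \<omega>) = L2 (-t) \<omega>"
      by (intro L2.left_limit) auto
    then show ?thesis
      by eventually_elim (use False in \<open>simp add: two_sided_def two_sided_mod_def\<close>)
  qed (simp add: two_sided_def two_sided_mod_def)
  \<comment> \<open>The factor 16 \<sigma> comes from \<open>L_integral_combination_bound\<close>,
    the rest from \<open>nn_integral_kernel_difference\<close>.\<close>
  define K where "K = 16 * \<sigma> * ((c_H H)\<^sup>2 * t\<^sup>2 * defect_const (H - 1/2) * (1/2) powr (2 * H - 2))"
  have K: "0 \<le> K"
  proof -
    have "\<bar>H - 1/2\<bar> < 1/2" using assms(1,2) by linarith
    then show ?thesis unfolding K_def using L.\<sigma>_nonneg defect_const_nonneg by auto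
  qed
  show ?case
  \<comment> \<open>S = 2|t| + 1 is positive and forces s > 2|t|. Since K is 0 for t = 0 or H = 1/2,
    K + 1 is taken as the positive constant.\<close>
  proof (rule exI[of _ "2 * \<bar>t\<bar> + 1"], rule conjI, simp, rule exI[of _ "K + 1"], intro conjI allI impI)
    show "0 < K + 1" using K by simp
    fix s X1 X2 X3
    assume s: "2 * \<bar>t\<bar> + 1 < s"
      and X1: "is_L_integral M (two_sided L1 L2) (\<lambda>v. indicator {-s..t} v * z_H H (t + s) (v + s)) X1"
      and X2: "is_L_integral M (two_sided L1 L2) (\<lambda>v. indicator {-s..0} v * z_H H s (v + s)) X2"
      and X3: "is_L_integral M (two_sided L1 L2) (\<lambda>v. pos_pow (t - v) (H - 1/2) - pos_pow (- v) (H - 1/2)) X3"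
    have "(\<integral>\<^sup>+ \<omega>. ennreal ((X1 \<omega> - X2 \<omega> - c_H H * X3 \<omega>)\<^sup>2) \<partial>M)
      \<le> ennreal (16 * \<sigma>) * (\<integral>\<^sup>+v. ennreal ((indicator {-s..t} v * z_H H (t + s) (v + s)
            - indicator {-s..0} v * z_H H s (v + s)
            - c_H H * (pos_pow (t - v) (H - 1/2) - pos_pow (- v) (H - 1/2)))\<^sup>2) \<partial>lborel)"
      by (intro L.L_integral_combination_bound is_L_integral_cong_AE[OF ae] X1 X2 X3) measurable
    also have "\<dots> \<le> ennreal (16 * \<sigma>) *
        ennreal ((c_H H)\<^sup>2 * t\<^sup>2 * defect_const (H - 1/2) * (1/2) powr (2 * H - 2) * s powr (2 * H - 2))"
      using s by (intro mult_left_mono nn_integral_kernel_difference assms(1,2)) auto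
    also have "\<dots> = ennreal (K * s powr (2 * H - 2))"
      using L.\<sigma>_nonneg by (simp add: K_def ennreal_mult'[symmetric] mult_ac)
    also have "\<dots> \<le> ennreal ((K + 1) * s powr (2 * H - 2))"
      by (intro ennreal_leI mult_right_mono) auto
    finally show "(\<integral>\<^sup>+ \<omega>. ennreal ((X1 \<omega> - X2 \<omega> - c_H H * X3 \<omega>)\<^sup>2) \<partial>M) \<le> ennreal ((K + 1) * s powr (2 * H - 2))" .
  qed
qed

end
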